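(* Let $d\ge 1$, let $H=(H_1,\dots,H_d)\in(0,1)^d$, put $\bar H=\frac{H_1+\cdots+H_d}{d}$, and let $W^H$ be a fractional Brownian sheet on $[0,1]^d$ of Hurst multiparameter $H$, with all sample paths in $C_0([0,1]^d)$. If $\bar H\le\frac{d-1}{d}$, then almost surely the sample path of $W^H$ is not chargeable.
   Context: A fractional Brownian sheet of Hurst multiparameter $H=(H_1,\dots,H_d)\in(0,1)^d$ is a centered Gaussian process $\{W^H_{t_1,\dots,t_d}:(t_1,\dots,t_d)\in[0,1]^d\}$ with covariance $\mathbb{E}(W^H_{t_1,\dots,t_d}W^H_{t'_1,\dots,t'_d})=\prod_{i=1}^d\frac{t_i^{2H_i}+t_i'^{2H_i}-|t_i-t'_i|^{2H_i}}{2}$. It has a continuous modification, and sample paths are taken in $C_0([0,1]^d)$, the space of continuous real functions on $[0,1]^d$ that vanish at every point having at least one zero coordinate. Increments: for $f\in C_0([0,1]^d)$ and a rectangle $K=\prod_{i=1}^d[a_i,b_i]\subseteq[0,1]^d$ (with $a_i<b_i$), $\Delta_f(K)=\sum_{(c_i)\in\prod_i\{a_i,b_i\}}(-1)^{\#\{i:\,c_i=a_i\}}f(c_1,\dots,c_d)$. A figure is a finite union of rectangles contained in $[0,1]^d$; $\Delta_f$ extends uniquely to a function on figures that is additive on almost disjoint figures (i.e. figures whose intersection is Lebesgue negligible). A $BV$-subset of $[0,1]^d$ is a measurable $B\subseteq[0,1]^d$ with finite perimeter $\|B\|=\|D\mathbf{1}_B\|(\mathbb{R}^d)<\infty$ (total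 variation of the distributional gradient of the indicator function); figures are $BV$-sets. A sequence $(B_n)$ of $BV$-subsets $BV$-converges to $B$ if $\sup_n\|B_n\|<\infty$ and $|B_n\triangle B|\to0$ (Lebesgue measure). A charge on $[0,1]^d$ is a real-valued function $\mu$ on the $BV$-subsets of $[0,1]^d$ such that $\mu(B_1\cup B_2)=\mu(B_1)+\mu(B_2)$ whenever $|B_1\cap B_2|=0$, and $\mu(B_n)\to\mu(B)$ whenever $(B_n)$ $BV$-converges to $B$. A function $f\in C_0([0,1]^d)$ is chargeable if $\Delta_f$ (defined on figures) extends to a charge on $[0,1]^d$. *)

theory Defs
  imports "HOL-Probability.Probability"
begin

section \<open>The space of paths and rectangular increments\<close>

text \<open>The dimension is \<open>d = CARD('n)\<close>; in \<open>real ^ 'n\<close> the constant \<open>1\<close> is the vector all of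
  whose components are 1.\<close>

abbreviation unit_cube :: "(real ^ 'n) set" where
  "unit_cube \<equiv> cbox 0 1"

text \<open>Functions on the cube are total functions on \<open>real ^ 'n\<close>; their values off the cube are
  irrelevant everywhere below.\<close>

definition C0_cube :: "(real ^ 'n \<Rightarrow> real) set" where
  "C0_cube = {f. continuous_on unit_cube f \<and>
                 (\<forall>x\<in>unit_cube. (\<exists>i. x $ i = 0) \<longrightarrow> f x = 0)}"

definition rect_increment :: "(real ^ 'n \<Rightarrow> real) \<Rightarrow> real ^ 'n \<Rightarrow> real ^ 'n \<Rightarrow> real" where
  "rect_increment f a b =
     (\<Sum>c | \<forall>i. c $ i \<in> {a $ i, b $ i}. (- 1) ^ card {i. c $ i = a $ i} * f c)"

definition rectangle :: "(real ^ 'n) set \<Rightarrow> bool" where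
  "rectangle K \<longleftrightarrow> (\<exists>a b. (\<forall>i. a $ i < b $ i) \<and> K = cbox a b \<and> K \<subseteq> unit_cube)"

definition figure :: "(real ^ 'n) set \<Rightarrow> bool" where
  "figure F \<longleftrightarrow> (\<exists>\<K>. finite \<K> \<and> (\<forall>K\<in>\<K>. rectangle K) \<and> F = \<Union>\<K>)"

text \<open>\<open>figure_increment f G\<close> says that \<open>G\<close> is the extension of the increments of \<open>f\<close> from
  rectangles to figures which is additive on almost disjoint figures. Such a \<open>G\<close> exists and its
  values on figures are unique; its values on other sets are unconstrained.\<close>

definition figure_increment :: "(real ^ 'n \<Rightarrow> real) \<Rightarrow> ((real ^ 'n) set \<Rightarrow> real) \<Rightarrow> bool" where
  "figure_increment f G \<longleftrightarrow>
     (\<forall>a b. (\<forall>i. a $ i < b $ i) \<and> cbox a b \<subseteq> unit_cube \<longrightarrow>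
        G (cbox a b) = rect_increment f a b) \<and>
     (\<forall>F1 F2. figure F1 \<and> figure F2 \<and> negligible (F1 \<inter> F2) \<longrightarrow>
        G (F1 \<union> F2) = G F1 + G F2)"

section \<open>Sets of finite perimeter and charges\<close>

definition divergence :: "(real ^ 'n \<Rightarrow> real ^ 'n) \<Rightarrow> real ^ 'n \<Rightarrow> real" where
  "divergence \<phi> x = trace (jacobian \<phi> (at x))"

text \<open>Compactly supported vector fields of class \<open>C\<^sup>1\<close>, bounded by 1 in the Euclidean norm.\<close>

definition test_fields :: "(real ^ 'n \<Rightarrow> real ^ 'n) set" where
  "test_fields = {\<phi>. (\<forall>x. \<phi> differentiable (at x)) \<and>
                     continuous_on UNIV (\<lambda>x. jacobian \<phi> (at x)) \<and>
                     compact (closure {x. \<phi> x \<noteq> 0}) \<and>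
                     (\<forall>x. norm (\<phi> x) \<le> 1)}"

text \<open>The total variation over the whole space of the distributional gradient \<open>Du\<close>, which acts on
  a vector field \<open>\<phi>\<close> as minus the integral of \<open>u\<close> times the divergence of \<open>\<phi>\<close>.\<close>

definition gradient_variation :: "(real ^ 'n \<Rightarrow> real) \<Rightarrow> ereal" where
  "gradient_variation u =
     (SUP \<phi>\<in>test_fields. ereal (- (LINT x|lebesgue. u x * divergence \<phi> x)))"

definition perimeter :: "(real ^ 'n) set \<Rightarrow> ereal" where
  "perimeter B = gradient_variation (indicator B)"

definition BV_subset :: "(real ^ 'n) set \<Rightarrow> bool" where
  "BV_subset B \<longleftrightarrow> B \<in> sets lebesgue \<and> B \<subseteq> unit_cube \<and> perimeter B < \<infinity>"

definition BV_converges :: "(nat \<Rightarrow> (real ^ 'n) set) \<Rightarrow> (real ^ 'n) set \<Rightarrow> bool" where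
  "BV_converges B L \<longleftrightarrow>
     (\<forall>n. BV_subset (B n)) \<and> BV_subset L \<and>
     (SUP n. perimeter (B n)) < \<infinity> \<and>
     (\<lambda>n. measure lebesgue ((B n - L) \<union> (L - B n))) \<longlonglongrightarrow> 0"

definition charge :: "((real ^ 'n) set \<Rightarrow> real) \<Rightarrow> bool" where
  "charge \<mu> \<longleftrightarrow>
     (\<forall>B1 B2. BV_subset B1 \<and> BV_subset B2 \<and> negligible (B1 \<inter> B2) \<longrightarrow>
        \<mu> (B1 \<union> B2) = \<mu> B1 + \<mu> B2) \<and>
     (\<forall>B L. BV_converges B L \<longrightarrow> (\<lambda>n. \<mu> (B n)) \<longlonglongrightarrow> \<mu> L)"

definition chargeable :: "(real ^ 'n \<Rightarrow> real) \<Rightarrow> bool" where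
  "chargeable f \<longleftrightarrow> f \<in> C0_cube \<and>
     (\<exists>G \<mu>. figure_increment f G \<and> charge \<mu> \<and> (\<forall>F. figure F \<longrightarrow> \<mu> F = G F))"

section \<open>Fractional Brownian sheets\<close>

text \<open>Degenerate Gaussian variables (almost sure constants) are allowed: the sheet vanishes where
  some coordinate is zero.\<close>

definition gaussian_rv :: "'a measure \<Rightarrow> ('a \<Rightarrow> real) \<Rightarrow> bool" where
  "gaussian_rv M X \<longleftrightarrow> X \<in> borel_measurable M \<and>
     (\<exists>m. (AE \<omega> in M. X \<omega> = m) \<or> (\<exists>\<sigma>>0. distributed M lborel X (normal_density m \<sigma>)))"

definition gaussian_process :: "'a measure \<Rightarrow> 'i set \<Rightarrow> ('i \<Rightarrow> 'a \<Rightarrow> real) \<Rightarrow> bool" where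
  "gaussian_process M T X \<longleftrightarrow>
     (\<forall>J c. finite J \<and> J \<subseteq> T \<longrightarrow> gaussian_rv M (\<lambda>\<omega>. \<Sum>t\<in>J. c t * X t \<omega>))"

definition fractional_brownian_sheet ::
    "'a measure \<Rightarrow> real ^ 'n \<Rightarrow> (real ^ 'n \<Rightarrow> 'a \<Rightarrow> real) \<Rightarrow> bool" where
  "fractional_brownian_sheet M H W \<longleftrightarrow>
     gaussian_process M unit_cube W \<and>
     (\<forall>t\<in>unit_cube. (LINT \<omega>|M. W t \<omega>) = 0) \<and>
     (\<forall>s\<in>unit_cube. \<forall>t\<in>unit_cube.
        (LINT \<omega>|M. W s \<omega> * W t \<omega>) =
        (\<Prod>i\<in>UNIV. ((s $ i) powr (2 * H $ i) + (t $ i) powr (2 * H $ i)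
                      - \<bar>s $ i - t $ i\<bar> powr (2 * H $ i)) / 2))"

end

theory Submission
  imports Defs "HOL-Real_Asymp.Real_Asymp"
begin

text \<open>
  The proof plays two estimates of the rectangular increments over small cubes against each other. Split
  the unit cube into cubes of side \<open>1 / m\<close>, keep only the layer of those touching one fixed face, and
  write \<open>N = m ^ (d - 1)\<close> for their number.

  A union of any of these cubes has perimeter at most \<open>2 d\<close> and volume at most \<open>1 / m\<close>. As \<open>m\<close> grows such
  unions therefore BV-converge to the empty set, and a charge extending the increments of \<open>f\<close> tends to
  0 along them. Choosing the cubes according to the sign of the increment shows that, for chargeable
  \<open>f\<close>, the sum of the absolute increments over the layer tends to 0
  (\<open>chargeable_sum_abs_rect_increment_tendsto_0\<close>). The perimeter bound is obtained from translation
  invariance of Lebesgue measure (\<open>integral_partial_derivative_box_le\<close>).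

  For the fractional Brownian sheet, each increment over a cube is a centered Gaussian variable with standard deviation
  \<open>\<sigma> = m powr (- (H\<^sub>1 + \<dots> + H\<^sub>d))\<close>. The hypothesis on the Hurst indices says exactly that \<open>N * \<sigma> \<ge> 1\<close>.
  Hence on the event that the path is chargeable the average over the layer of \<open>\<bar>X\<^sub>k\<bar>\<close>, with \<open>X\<^sub>k\<close> the
  normalized increments, tends to 0, and because of \<open>1 - cos x \<le> \<bar>x\<bar>\<close> the average of \<open>cos X\<^sub>k\<close> tends to 1.

  However, \<open>cos X\<^sub>k\<close> has mean \<open>exp (- 1 / 2)\<close>, and the variance of the average is at most the mean of the squared
  correlations (\<open>cos_average_variance_le\<close>). The correlations are products over the coordinates of
  autocovariances of fractional Gaussian noise, which decay with the distance of the cubes, so this mean tends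
  to 0 (\<open>slab_mean_square_correlation_le\<close>). Along a subsequence the averages thus converge almost surely to
  \<open>exp (- 1 / 2) < 1\<close>, and the event has probability 0.
\<close>

section \<open>Perimeter of almost disjoint unions of boxes\<close>

text \<open>Translating a box by \<open>h\<close> along one axis uncovers a slice of thickness \<open>h\<close> at one end and covers a
  new one at the other end. The product on the right is the area of the faces orthogonal to that
  axis, so these bounds are where the perimeter of a box comes from.\<close>

lemma measure_lborel_cbox_translate_diff_le:
  fixes a b :: "real ^ 'n"
  assumes ab: "\<And>j. a $ j \<le> b $ j" and h: "0 \<le> h"
  shows "measure lborel (cbox a b - cbox (a + h *\<^sub>R axis i 1) (b + h *\<^sub>R axis i 1))
           \<le> h * (\<Prod>j\<in>UNIV - {i}. b $ j - a $ j)" (is "measure lborel (?K - ?Kh) \<le> _")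
    and "measure lborel (cbox (a + h *\<^sub>R axis i 1) (b + h *\<^sub>R axis i 1) - cbox a b)
           \<le> h * (\<Prod>j\<in>UNIV - {i}. b $ j - a $ j)"
proof -
  let ?b = "\<chi> j. if j = i then a $ i + h else b $ j"
  let ?a = "\<chi> j. if j = i then b $ i else a $ j"
  let ?P = "\<Prod>j\<in>UNIV - {i}. b $ j - a $ j"
  have split: "(\<Prod>j\<in>UNIV. f j) = f i * (\<Prod>j\<in>UNIV - {i}. f j)" for f :: "'n \<Rightarrow> real"
    by (rule prod.remove) auto
  have sub1: "?K - ?Kh \<subseteq> cbox a ?b"
  proof
    fix x assume x: "x \<in> ?K - ?Kh"
    then have "\<exists>j. \<not> ((a + h *\<^sub>R axis i 1) $ j \<le> x $ j \<and> x $ j \<le> (b + h *\<^sub>R axis i 1) $ j)"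
      by (auto simp: mem_box_cart)
    then obtain j where j: "\<not> ((a + h *\<^sub>R axis i 1) $ j \<le> x $ j \<and> x $ j \<le> (b + h *\<^sub>R axis i 1) $ j)" ..
    have inK: "a $ k \<le> x $ k" "x $ k \<le> b $ k" for k using x by (auto simp: mem_box_cart)
    have ji: "j = i" using j inK[of j] h by (auto simp: axis_def split: if_splits)
    then have "x $ i \<le> a $ i + h" using j inK[of i] h by (auto simp: axis_def)
    then show "x \<in> cbox a ?b" using inK by (auto simp: mem_box_cart)
  qed
  have sub2: "?Kh - ?K \<subseteq> cbox ?a (b + h *\<^sub>R axis i 1)"
  proof
    fix x assume x: "x \<in> ?Kh - ?K"
    then have "\<exists>j. \<not> (a $ j \<le> x $ j \<and> x $ j \<le> b $ j)"
      by (auto simp: mem_box_cart)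
    then obtain j where j: "\<not> (a $ j \<le> x $ j \<and> x $ j \<le> b $ j)" ..
    have inK: "(a + h *\<^sub>R axis i 1) $ k \<le> x $ k" "x $ k \<le> (b + h *\<^sub>R axis i 1) $ k" for k
      using x by (auto simp: mem_box_cart)
    have ji: "j = i" using j inK[of j] h by (auto simp: axis_def split: if_splits)
    then have "b $ i \<le> x $ i" using j inK[of i] h by (auto simp: axis_def)
    moreover have "a $ k \<le> x $ k" if "k \<noteq> i" for k
      using inK(1)[of k] that by (simp add: axis_def)
    ultimately show "x \<in> cbox ?a (b + h *\<^sub>R axis i 1)" using inK(2)
      unfolding mem_box_cart by simp
  qed
  have ne1: "cbox a ?b \<noteq> {}" and ne2: "cbox ?a (b + h *\<^sub>R axis i 1) \<noteq> {}"
    using ab h by (auto simp: interval_eq_empty_cart axis_def not_less intro: order_trans)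
  have m1: "measure lborel (cbox a ?b) = h * ?P"
    unfolding content_cbox_cart[OF ne1] by (subst split) (auto intro!: prod.cong)
  have m2: "measure lborel (cbox ?a (b + h *\<^sub>R axis i 1)) = h * ?P"
    unfolding content_cbox_cart[OF ne2] by (subst split) (auto simp: axis_def intro!: prod.cong)
  show "measure lborel (?K - ?Kh) \<le> h * ?P"
    unfolding m1[symmetric] using sub1
    by (intro measure_mono_fmeasurable) (auto simp: )
  show "measure lborel (?Kh - ?K) \<le> h * ?P"
    unfolding m2[symmetric] using sub2
    by (intro measure_mono_fmeasurable) (auto simp: )
qed

lemma lborel_integral_translation:
  fixes f :: "'a::euclidean_space \<Rightarrow> real"
  assumes "f \<in> borel_measurable borel"
  shows "(LINT x|lborel. f (c + x)) = (LINT x|lborel. f x)"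
proof -
  have "(LINT x|lborel. f x) = (LINT x|distr lborel borel ((+) c). f x)"
    by (simp add: lborel_distr_plus)
  also have "\<dots> = (LINT x|lborel. f (c + x))"
    using assms by (intro integral_distr) auto
  finally show ?thesis by simp
qed

text \<open>A divergence theorem with no boundary integral and no iterated integration. The integral over the box
  of the difference quotient of \<open>g\<close> is, by translation invariance, \<open>1 / h\<close> times the difference of the
  integrals of \<open>g\<close> over the translated box and over the box, and for \<open>\<bar>g\<bar> \<le> 1\<close> the two thin slices
  where the boxes differ contribute at most \<open>2 h\<close> times the area of a face. Letting \<open>h\<close> tend to 0
  under dominated convergence gives the bound.\<close>

lemma integral_partial_derivative_box_le:
  fixes g g' :: "real ^ 'n \<Rightarrow> real"
  assumes ab: "\<And>j. a $ j \<le> b $ j"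
    and g1: "\<And>x. \<bar>g x\<bar> \<le> 1"
    and g'_cont: "continuous_on UNIV g'"
    and g_cont: "continuous_on UNIV g"
    and deriv: "\<And>x t. ((\<lambda>t. g (x + t *\<^sub>R axis i 1)) has_real_derivative g' (x + t *\<^sub>R axis i 1)) (at t)"
  shows "\<bar>LINT x|lborel. indicator (cbox a b) x * g' x\<bar> \<le> 2 * (\<Prod>j\<in>UNIV - {i}. b $ j - a $ j)"
proof -
  let ?e = "axis i 1 :: real ^ 'n"
  let ?K = "cbox a b"
  let ?P = "\<Prod>j\<in>UNIV - {i}. b $ j - a $ j"
  define h where "h n = 1 / real (Suc n)" for n
  have h: "0 < h n" "h n \<le> 1" for n by (auto simp: h_def)
  have h0: "h \<longlonglongrightarrow> 0" unfolding h_def by (rule LIMSEQ_Suc) (rule lim_const_over_n)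
  define D where "D n x = indicator ?K x * ((g (x + h n *\<^sub>R ?e) - g x) / h n)" for n x
  have g_meas [measurable]: "g \<in> borel_measurable borel" and g'_meas [measurable]: "g' \<in> borel_measurable borel"
    using g_cont g'_cont by (auto intro: borel_measurable_continuous_onI)
  \<comment> \<open>The box is enlarged by one unit because the mean value point of a quotient with step at most 1
    may leave it.\<close>
  have "compact (g' ` cbox a (b + ?e))"
    by (intro compact_continuous_image continuous_on_subset[OF g'_cont]) auto
  then obtain B where B: "\<And>x. x \<in> cbox a (b + ?e) \<Longrightarrow> \<bar>g' x\<bar> \<le> B"
    by (force dest!: compact_imp_bounded simp: bounded_iff)
  have quot: "\<bar>D n x\<bar> \<le> indicator ?K x * B" for n x
  proof (cases "x \<in> ?K")
    case True
    obtain z where z: "0 < z" "z < h n" "g (x + h n *\<^sub>R ?e) - g (x + 0 *\<^sub>R ?e) = (h n - 0) * g' (x + z *\<^sub>R ?e)"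
      using MVT2[OF h(1)[of n], of "\<lambda>t. g (x + t *\<^sub>R ?e)" "\<lambda>t. g' (x + t *\<^sub>R ?e)"] deriv by blast
    have "x + z *\<^sub>R ?e \<in> cbox a (b + ?e)"
      unfolding mem_box_cart
    proof
      fix j
      have "a $ j \<le> x $ j" "x $ j \<le> b $ j" using True by (auto simp: mem_box_cart)
      then show "a $ j \<le> (x + z *\<^sub>R ?e) $ j \<and> (x + z *\<^sub>R ?e) $ j \<le> (b + ?e) $ j"
        using z h(2)[of n] by (auto simp: axis_def)
    qed
    then have "\<bar>g' (x + z *\<^sub>R ?e)\<bar> \<le> B" by (rule B)
    then show ?thesis using True z(3) h(1)[of n] by (simp add: D_def)
  qed (simp add: D_def)
  have lim: "(\<lambda>n. D n x) \<longlonglongrightarrow> indicator ?K x * g' x" for x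
  proof -
    have "((\<lambda>t. (g (x + t *\<^sub>R ?e) - g x) / t) \<longlongrightarrow> g' x) (at 0)"
      using deriv[of x 0] by (simp add: DERIV_def)
    moreover have "filterlim h (at 0) sequentially"
      using h0 h(1) by (auto simp: filterlim_at less_imp_neq[symmetric] intro!: always_eventually)
    ultimately have "(\<lambda>n. (g (x + h n *\<^sub>R ?e) - g x) / h n) \<longlonglongrightarrow> g' x"
      by (rule filterlim_compose)
    then show ?thesis unfolding D_def by (intro tendsto_intros)
  qed
  have intK: "integrable lborel (\<lambda>x. indicator ?K x * B)"
    by (intro integrable_mult_left) (auto intro!: integrable_real_indicator emeasure_lborel_cbox_finite)
  have conv: "(\<lambda>n. LINT x|lborel. D n x) \<longlonglongrightarrow> (LINT x|lborel. indicator ?K x * g' x)"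
  proof (rule integral_dominated_convergence[OF _ _ intK])
    show "D n \<in> borel_measurable lborel" for n
      unfolding D_def by measurable
  qed (use quot lim in auto)
  have bnd: "\<bar>LINT x|lborel. D n x\<bar> \<le> 2 * ?P" for n
  proof -
    let ?Kh = "cbox (a + h n *\<^sub>R ?e) (b + h n *\<^sub>R ?e)"
    have fin: "emeasure lborel ?K < \<infinity>" "emeasure lborel ?Kh < \<infinity>"
      by (rule emeasure_lborel_cbox_finite)+
    have i1: "integrable lborel (\<lambda>x. indicator S x * g x)"
      if [measurable]: "S \<in> sets borel" and "emeasure lborel S < \<infinity>" for S
    proof (rule Bochner_Integration.integrable_bound)
      show "integrable lborel (indicator S :: _ \<Rightarrow> real)"
        using that by (intro integrable_real_indicator) auto
      show "AE x in lborel. norm (indicator S x * g x) \<le> norm (indicator S x :: real)"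
        using g1 by (intro AE_I2) (simp add: indicator_def)
    qed measurable
    have i2: "integrable lborel (\<lambda>x. indicator ?K x * g (x + h n *\<^sub>R ?e))"
    proof (rule Bochner_Integration.integrable_bound)
      show "integrable lborel (indicator ?K :: _ \<Rightarrow> real)"
        using fin by (intro integrable_real_indicator) auto
      show "AE x in lborel. norm (indicator ?K x * g (x + h n *\<^sub>R ?e)) \<le> norm (indicator ?K x :: real)"
        using g1 by (intro AE_I2) (simp add: indicator_def)
    qed measurable
    have diff: "integrable lborel (indicator (S - T) :: _ \<Rightarrow> real)"
      if "emeasure lborel S < \<infinity>" and [measurable]: "S \<in> sets borel" "T \<in> sets borel"
      for S T :: "(real ^ 'n) set"
      using that by (intro integrable_real_indicator le_less_trans[OF emeasure_mono that(1)]) auto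
    have "(LINT x|lborel. indicator ?K x * g (x + h n *\<^sub>R ?e)) =
          (LINT x|lborel. (\<lambda>y. indicator ?Kh y * g y) (h n *\<^sub>R ?e + x))"
      by (intro Bochner_Integration.integral_cong)
         (auto simp: indicator_def mem_box_cart add.commute)
    also have "\<dots> = (LINT x|lborel. indicator ?Kh x * g x)"
      by (rule lborel_integral_translation) measurable
    finally have tr: "(LINT x|lborel. indicator ?K x * g (x + h n *\<^sub>R ?e)) =
          (LINT x|lborel. indicator ?Kh x * g x)" .
    have "(LINT x|lborel. D n x) = 
       (LINT x|lborel. (indicator ?K x * g (x + h n *\<^sub>R ?e) - indicator ?K x * g x) / h n)"
      unfolding D_def by (simp add: algebra_simps)
    also have "\<dots> = ((LINT x|lborel. indicator ?Kh x * g x) - (LINT x|lborel. indicator ?K x * g x)) / h n"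
      using i1[of ?K] i2 fin tr by simp
    also have "\<dots> = (LINT x|lborel. indicator ?Kh x * g x - indicator ?K x * g x) / h n"
      using i1[of ?K] i1[of ?Kh] fin by simp
    finally have eq: "(LINT x|lborel. D n x) = (LINT x|lborel. indicator ?Kh x * g x - indicator ?K x * g x) / h n" .
    have "\<bar>LINT x|lborel. indicator ?Kh x * g x - indicator ?K x * g x\<bar> \<le>
        (LINT x|lborel. \<bar>indicator ?Kh x * g x - indicator ?K x * g x\<bar>)"
      by (rule integral_abs_bound)
    also have "\<dots> \<le> (LINT x|lborel. indicator (?Kh - ?K) x + indicator (?K - ?Kh) x)"
    proof (rule integral_mono)
      show "integrable lborel (\<lambda>x. \<bar>indicator ?Kh x * g x - indicator ?K x * g x\<bar>)"
        using i1[of ?K] i1[of ?Kh] fin by (intro integrable_abs Bochner_Integration.integrable_diff) auto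
      show "integrable lborel (\<lambda>x. indicator (?Kh - ?K) x + indicator (?K - ?Kh) x :: real)"
        using fin by (intro Bochner_Integration.integrable_add diff) auto
    qed (use g1 in \<open>auto simp: indicator_def\<close>)
    also have "\<dots> = measure lborel (?Kh - ?K) + measure lborel (?K - ?Kh)"
      using fin by (subst Bochner_Integration.integral_add) (auto intro: diff)
    also have "\<dots> \<le> h n * ?P + h n * ?P"
      using h(1)[of n] by (intro add_mono measure_lborel_cbox_translate_diff_le ab) auto
    finally show ?thesis unfolding eq using h(1)[of n] by (simp add: field_simps)
  qed
  show ?thesis
    by (rule LIMSEQ_le_const2[OF tendsto_rabs[OF conv]]) (use bnd in blast)
qed

lemma test_field_component_derivative:
  fixes \<phi> :: "real ^ 'n \<Rightarrow> real ^ 'n"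
  assumes "\<phi> \<in> test_fields"
  shows "((\<lambda>t. \<phi> (x + t *\<^sub>R axis i 1) $ i) has_real_derivative
            jacobian \<phi> (at (x + t *\<^sub>R axis i 1)) $ i $ i) (at t)"
proof -
  let ?y = "x + t *\<^sub>R axis i 1"
  have d: "(\<phi> has_derivative (\<lambda>h. jacobian \<phi> (at ?y) *v h)) (at ?y)"
    using assms by (simp add: test_fields_def flip: jacobian_works)
  have line: "((\<lambda>t. x + t *\<^sub>R axis i 1) has_derivative (\<lambda>s. s *\<^sub>R axis i 1)) (at t)"
    by (auto intro!: derivative_eq_intros)
  have "((\<lambda>t. \<phi> (x + t *\<^sub>R axis i 1) $ i) has_derivative
          (\<lambda>s. (jacobian \<phi> (at ?y) *v (s *\<^sub>R axis i 1)) $ i)) (at t)"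
    using diff_chain_at[OF line d] bounded_linear.has_derivative[OF bounded_linear_vec_nth]
    by (fastforce simp: o_def)
  moreover have "(jacobian \<phi> (at ?y) *v (s *\<^sub>R axis i 1)) $ i = jacobian \<phi> (at ?y) $ i $ i * s" for s
    by (simp add: matrix_vector_mult_def axis_def if_distrib cong: if_cong)
  ultimately show ?thesis by (simp add: has_field_derivative_def)
qed

lemma continuous_on_divergence:
  assumes "\<phi> \<in> test_fields"
  shows "continuous_on UNIV (divergence \<phi>)"
  using assms unfolding divergence_def[abs_def] trace_def test_fields_def
  by (auto intro!: continuous_intros)

lemma integral_divergence_box_le:
  fixes \<phi> :: "real ^ 'n \<Rightarrow> real ^ 'n"
  assumes \<phi>: "\<phi> \<in> test_fields" and ab: "\<And>j. a $ j \<le> b $ j"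
  shows "integrable lborel (\<lambda>x. indicator (cbox a b) x * divergence \<phi> x)"
    and "\<bar>LINT x|lborel. indicator (cbox a b) x * divergence \<phi> x\<bar>
           \<le> 2 * (\<Sum>i\<in>UNIV. \<Prod>j\<in>UNIV - {i}. b $ j - a $ j)"
proof -
  define J where "J i x = jacobian \<phi> (at x) $ i $ i" for i x
  have Jc: "continuous_on UNIV (J i)" for i
    using \<phi> unfolding J_def test_fields_def by (auto intro!: continuous_intros)
  have Ji: "integrable lborel (\<lambda>x. indicator (cbox a b) x * J i x)" for i
    using borel_integrable_compact[OF compact_cbox continuous_on_subset[OF Jc subset_UNIV]]
    by (simp add: indicator_scaleR_eq_if if_distrib)
  have div: "indicator (cbox a b) x * divergence \<phi> x = (\<Sum>i\<in>UNIV. indicator (cbox a b) x * J i x)" for x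
    by (simp add: divergence_def trace_def J_def sum_distrib_left)
  show "integrable lborel (\<lambda>x. indicator (cbox a b) x * divergence \<phi> x)"
    unfolding div using Ji by (intro Bochner_Integration.integrable_sum)
  have "(LINT x|lborel. indicator (cbox a b) x * divergence \<phi> x)
      = (\<Sum>i\<in>UNIV. LINT x|lborel. indicator (cbox a b) x * J i x)"
    unfolding div using Ji by (intro Bochner_Integration.integral_sum)
  also have "\<bar>\<dots>\<bar> \<le> (\<Sum>i\<in>UNIV. \<bar>LINT x|lborel. indicator (cbox a b) x * J i x\<bar>)"
    by (rule sum_abs)
  also have "\<dots> \<le> (\<Sum>i\<in>UNIV. 2 * (\<Prod>j\<in>UNIV - {i}. b $ j - a $ j))"
  proof (intro sum_mono integral_partial_derivative_box_le[where g="\<lambda>x. \<phi> x $ i" for i, OF ab _ Jc])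
    fix i
    show "\<bar>\<phi> x $ i\<bar> \<le> 1" for x
      using \<phi> component_le_norm_cart[of "\<phi> x" i] by (force simp: test_fields_def intro: order_trans)
    show "continuous_on UNIV (\<lambda>x. \<phi> x $ i)"
      using \<phi> by (intro continuous_on_component)
        (simp add: test_fields_def differentiable_imp_continuous_on differentiable_at_imp_differentiable_on)
    show "((\<lambda>t. \<phi> (x + t *\<^sub>R axis i 1) $ i) has_real_derivative J i (x + t *\<^sub>R axis i 1)) (at t)" for x t
      unfolding J_def by (rule test_field_component_derivative[OF \<phi>])
  qed
  finally show "\<bar>LINT x|lborel. indicator (cbox a b) x * divergence \<phi> x\<bar>
           \<le> 2 * (\<Sum>i\<in>UNIV. \<Prod>j\<in>UNIV - {i}. b $ j - a $ j)"
    by (simp add: sum_distrib_left)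
qed

text \<open>The bound is subadditivity of the perimeter: the indicator of the union agrees almost everywhere with
  the sum of the indicators, so that the integral of a divergence splits over the boxes. Faces shared by
  two boxes are counted twice, which is harmless because only boundedness matters.\<close>

lemma perimeter_almost_disjoint_boxes_le:
  fixes a b :: "'k \<Rightarrow> real ^ 'n"
  assumes fin: "finite S" and ab: "\<And>k j. k \<in> S \<Longrightarrow> a k $ j \<le> b k $ j"
    and disj: "\<And>k l. k \<in> S \<Longrightarrow> l \<in> S \<Longrightarrow> k \<noteq> l \<Longrightarrow> negligible (cbox (a k) (b k) \<inter> cbox (a l) (b l))"
  shows "perimeter (\<Union>k\<in>S. cbox (a k) (b k))
           \<le> ereal (\<Sum>k\<in>S. 2 * (\<Sum>i\<in>UNIV. \<Prod>j\<in>UNIV - {i}. b k $ j - a k $ j))"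
  unfolding perimeter_def gradient_variation_def
proof (rule SUP_least)
  fix \<phi> :: "real ^ 'n \<Rightarrow> real ^ 'n" assume \<phi>: "\<phi> \<in> test_fields"
  let ?F = "\<Union>k\<in>S. cbox (a k) (b k)"
  have [measurable]: "divergence \<phi> \<in> borel_measurable borel"
    using continuous_on_divergence[OF \<phi>] by (rule borel_measurable_continuous_onI)
  have F: "?F \<in> sets borel"
    using fin by (intro sets.finite_UN) auto
  let ?Q = "{(k, l). k \<in> S \<and> l \<in> S \<and> k \<noteq> l}"
  let ?N = "\<Union>(k, l)\<in>?Q. cbox (a k) (b k) \<inter> cbox (a l) (b l)"
  have "finite ?Q"
    by (rule finite_subset[of _ "S \<times> S"]) (use fin in auto)
  moreover have "negligible (case p of (k, l) \<Rightarrow> cbox (a k) (b k) \<inter> cbox (a l) (b l))" if "p \<in> ?Q" for p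
    using that disj by (cases p) simp
  ultimately have "negligible ?N"
    by (intro negligible_Union finite_imageI) (simp, blast)
  then have N: "AE x in lebesgue. x \<notin> ?N"
    by (intro AE_not_in) (simp add: negligible_iff_null_sets)
  have "(LINT x|lebesgue. indicator ?F x * divergence \<phi> x)
      = (LINT x|lebesgue. (\<Sum>k\<in>S. indicator (cbox (a k) (b k)) x) * divergence \<phi> x)"
  proof (rule integral_cong_AE)
    show "AE x in lebesgue. indicator ?F x * divergence \<phi> x
            = (\<Sum>k\<in>S. indicator (cbox (a k) (b k)) x) * divergence \<phi> x"
      using N
    proof eventually_elim
      case (elim x)
      have "indicator ?F x = (\<Sum>k\<in>S. indicator (cbox (a k) (b k)) x :: real)"
      proof (cases "x \<in> ?F")
        case True
        then obtain k where k: "k \<in> S" "x \<in> cbox (a k) (b k)" by blast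
        have "(\<Sum>l\<in>S. indicator (cbox (a l) (b l)) x :: real) = (\<Sum>l\<in>{k}. indicator (cbox (a l) (b l)) x)"
          using k fin elim by (intro sum.mono_neutral_right) (auto simp: indicator_def)
        then show ?thesis using k True by simp
      qed (auto simp: indicator_def)
      then show ?case by simp
    qed
    have m: "g \<in> borel_measurable lebesgue" if "g \<in> borel_measurable borel" for g :: "real ^ 'n \<Rightarrow> real"
      using that by (intro measurable_completion) simp
    show "(\<lambda>x. indicator ?F x * divergence \<phi> x) \<in> borel_measurable lebesgue"
      using F by (intro m borel_measurable_times borel_measurable_indicator) auto
    show "(\<lambda>x. (\<Sum>k\<in>S. indicator (cbox (a k) (b k)) x) * divergence \<phi> x) \<in> borel_measurable lebesgue"
      by (intro m borel_measurable_times borel_measurable_sum borel_measurable_indicator) auto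
  qed
  also have "\<dots> = (LINT x|lborel. (\<Sum>k\<in>S. indicator (cbox (a k) (b k)) x * divergence \<phi> x))"
    by (subst integral_completion) (auto simp: sum_distrib_right)
  also have "\<dots> = (\<Sum>k\<in>S. LINT x|lborel. indicator (cbox (a k) (b k)) x * divergence \<phi> x)"
    by (intro Bochner_Integration.integral_sum integral_divergence_box_le(1) \<phi> ab)
  also have "\<bar>\<dots>\<bar> \<le> (\<Sum>k\<in>S. \<bar>LINT x|lborel. indicator (cbox (a k) (b k)) x * divergence \<phi> x\<bar>)"
    by (rule sum_abs)
  also have "\<dots> \<le> (\<Sum>k\<in>S. 2 * (\<Sum>i\<in>UNIV. \<Prod>j\<in>UNIV - {i}. b k $ j - a k $ j))"
    by (intro sum_mono integral_divergence_box_le(2) \<phi> ab)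
  finally show "ereal (- (LINT x|lebesgue. indicator ?F x * divergence \<phi> x))
      \<le> ereal (\<Sum>k\<in>S. 2 * (\<Sum>i\<in>UNIV. \<Prod>j\<in>UNIV - {i}. b k $ j - a k $ j))"
    by simp
qed

section \<open>Averages of cosines of Gaussian variables\<close>

text \<open>The cosine is used because its mean under a Gaussian law is the real part of the characteristic
  function. Constants count as Gaussian; if centered, they vanish almost surely.\<close>

lemma (in prob_space) centered_gaussian_moments:
  assumes Z: "gaussian_rv M Z" and mean: "expectation Z = 0"
  shows "integrable M (\<lambda>\<omega>. (Z \<omega>)\<^sup>2)"
    and "expectation (\<lambda>\<omega>. cos (Z \<omega>)) = exp (- expectation (\<lambda>\<omega>. (Z \<omega>)\<^sup>2) / 2)"
proof -
  have [measurable]: "Z \<in> borel_measurable M" using Z by (simp add: gaussian_rv_def)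
  obtain m where m: "(AE \<omega> in M. Z \<omega> = m) \<or> (\<exists>\<sigma>>0. distributed M lborel Z (normal_density m \<sigma>))"
    using Z by (auto simp: gaussian_rv_def)
  have "integrable M (\<lambda>\<omega>. (Z \<omega>)\<^sup>2) \<and>
    expectation (\<lambda>\<omega>. cos (Z \<omega>)) = exp (- expectation (\<lambda>\<omega>. (Z \<omega>)\<^sup>2) / 2)"
    using m
  proof
    assume const: "AE \<omega> in M. Z \<omega> = m"
    have "expectation Z = expectation (\<lambda>_. m)"
      using const by (intro integral_cong_AE) auto
    then have "m = 0" using mean by (simp add: prob_space)
    then have z: "AE \<omega> in M. Z \<omega> = 0" using const by simp
    have "integrable M (\<lambda>\<omega>. (Z \<omega>)\<^sup>2) \<longleftrightarrow> integrable M (\<lambda>_. 0 :: real)"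
      using z by (intro integrable_cong_AE) auto
    moreover have "expectation (\<lambda>\<omega>. cos (Z \<omega>)) = expectation (\<lambda>_. 1)"
      using z by (intro integral_cong_AE) auto
    moreover have "expectation (\<lambda>\<omega>. (Z \<omega>)\<^sup>2) = expectation (\<lambda>_. 0)"
      using z by (intro integral_cong_AE) auto
    ultimately show ?thesis by (simp add: prob_space)
  next
    assume "\<exists>\<sigma>>0. distributed M lborel Z (normal_density m \<sigma>)"
    then obtain \<sigma> where \<sigma>: "0 < \<sigma>" and "distributed M lborel Z (normal_density m \<sigma>)" by blast
    moreover from this have "m = 0" using normal_distributed_expectation mean by blast
    ultimately have D: "distributed M lborel Z (normal_density 0 \<sigma>)" by simp
    have int: "integrable M (\<lambda>\<omega>. (Z \<omega>)\<^sup>2)"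
      using distributed_integrable[OF D, of "\<lambda>x. x\<^sup>2"] integrable_normal_moment[OF \<sigma>, of 0 2] by simp
    have var: "expectation (\<lambda>\<omega>. (Z \<omega>)\<^sup>2) = \<sigma>\<^sup>2"
      using normal_distributed_variance[OF \<sigma> D] mean by simp
    have D1: "distributed M lborel (\<lambda>\<omega>. Z \<omega> / \<sigma>) std_normal_density"
      using D normal_standard_normal_convert[OF \<sigma>, of Z 0] by simp
    interpret N: real_distribution std_normal_distribution by (rule real_dist_normal_dist)
    have "expectation (\<lambda>\<omega>. cos (Z \<omega>)) = expectation (\<lambda>\<omega>. cos (\<sigma> * (Z \<omega> / \<sigma>)))"
      using \<sigma> by simp
    also have "\<dots> = (LINT x|lborel. std_normal_density x * cos (\<sigma> * x))"
      using distributed_integral[OF D1, of "\<lambda>x. cos (\<sigma> * x)"] by simp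
    also have "\<dots> = (LINT x|std_normal_distribution. cos (\<sigma> * x))"
      by (subst integral_density) auto
    also have "\<dots> = (LINT x|std_normal_distribution. Re (iexp (\<sigma> * x)))"
      by (simp add: Re_exp)
    also have "\<dots> = Re (char std_normal_distribution \<sigma>)"
      unfolding char_def by (intro integral_Re N.integrable_iexp) auto
    also have "\<dots> = exp (- \<sigma>\<^sup>2 / 2)"
      by (simp only: char_std_normal_distribution Re_complex_of_real)
    finally show ?thesis using int var by simp
  qed
  then show "integrable M (\<lambda>\<omega>. (Z \<omega>)\<^sup>2)"
    and "expectation (\<lambda>\<omega>. cos (Z \<omega>)) = exp (- expectation (\<lambda>\<omega>. (Z \<omega>)\<^sup>2) / 2)" by auto
qed

lemma integrable_mult_square_integrable:
  fixes X Y :: "'a \<Rightarrow> real"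
  assumes [measurable]: "X \<in> borel_measurable M" "Y \<in> borel_measurable M"
    and "integrable M (\<lambda>\<omega>. (X \<omega>)\<^sup>2)" "integrable M (\<lambda>\<omega>. (Y \<omega>)\<^sup>2)"
  shows "integrable M (\<lambda>\<omega>. X \<omega> * Y \<omega>)"
proof (rule Bochner_Integration.integrable_bound)
  show "integrable M (\<lambda>\<omega>. (X \<omega>)\<^sup>2 + (Y \<omega>)\<^sup>2)" using assms by simp
  show "AE \<omega> in M. norm (X \<omega> * Y \<omega>) \<le> norm ((X \<omega>)\<^sup>2 + (Y \<omega>)\<^sup>2)"
  proof (intro AE_I2)
    fix \<omega>
    have "2 * (\<bar>X \<omega>\<bar> * \<bar>Y \<omega>\<bar>) \<le> (X \<omega>)\<^sup>2 + (Y \<omega>)\<^sup>2"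
      using sum_squares_bound[of "\<bar>X \<omega>\<bar>" "\<bar>Y \<omega>\<bar>"] by simp
    moreover have "0 \<le> \<bar>X \<omega>\<bar> * \<bar>Y \<omega>\<bar>" by simp
    ultimately have "\<bar>X \<omega>\<bar> * \<bar>Y \<omega>\<bar> \<le> (X \<omega>)\<^sup>2 + (Y \<omega>)\<^sup>2" by linarith
    then show "norm (X \<omega> * Y \<omega>) \<le> norm ((X \<omega>)\<^sup>2 + (Y \<omega>)\<^sup>2)"
      by (simp add: abs_mult)
  qed
qed measurable

text \<open>The left-hand side is \<open>cosh x - 1\<close>, which is, up to the factor \<open>1 / e\<close>, the covariance of the cosines of two
  standard Gaussian variables with correlation \<open>x\<close>.\<close>

lemma cosh_le_1_plus_square:
  assumes "\<bar>x :: real\<bar> \<le> 1"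
  shows "(exp x + exp (- x)) / 2 - 1 \<le> x\<^sup>2"
proof -
  have *: "(exp y + exp (- y)) / 2 - 1 \<le> y\<^sup>2" if "0 \<le> y" "y \<le> 1" for y :: real
  proof -
    have "exp y \<le> 1 + y + y\<^sup>2" using that by (rule exp_bound)
    moreover have "exp (- y) \<le> 1 - y + y\<^sup>2"
    proof -
      have "exp (- y) \<le> 1 / (1 + y)"
        using exp_ge_add_one_self[of y] that by (simp add: exp_minus field_simps)
      also have "\<dots> \<le> 1 - y + y\<^sup>2"
        using that by (simp add: field_simps power2_eq_square)
      finally show ?thesis .
    qed
    ultimately have "exp y + exp (- y) \<le> (1 + y + y\<^sup>2) + (1 - y + y\<^sup>2)" by (rule add_mono)
    then show ?thesis by argo
  qed
  show ?thesis using *[of x] *[of "- x"] assms by (cases "0 \<le> x") (auto simp: add.commute)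
qed

text \<open>A weak law of large numbers for the cosines of standard, jointly Gaussian variables. By
  \<open>cos x * cos y = (cos (x - y) + cos (x + y)) / 2\<close>, the covariance of two cosines only needs the laws of the
  sum and of the difference, which are Gaussian again; with correlation \<open>\<rho>\<close> it equals
  \<open>(cosh \<rho> - 1) / e\<close> and is thus at most \<open>\<rho>\<^sup>2\<close>.\<close>

lemma (in prob_space) cos_average_variance_le:
  fixes X :: "'k \<Rightarrow> 'a \<Rightarrow> real"
  assumes fin: "finite S" and ne: "S \<noteq> {}"
    and gauss: "\<And>c. gaussian_rv M (\<lambda>\<omega>. \<Sum>k\<in>S. c k * X k \<omega>)"
    and mean: "\<And>k. k \<in> S \<Longrightarrow> expectation (X k) = 0"
    and var: "\<And>k. k \<in> S \<Longrightarrow> expectation (\<lambda>\<omega>. (X k \<omega>)\<^sup>2) = 1"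
  shows "expectation (\<lambda>\<omega>. ((\<Sum>k\<in>S. cos (X k \<omega>)) / card S - exp (- 1 / 2))\<^sup>2)
           \<le> (\<Sum>k\<in>S. \<Sum>l\<in>S. (expectation (\<lambda>\<omega>. X k \<omega> * X l \<omega>))\<^sup>2) / (real (card S))\<^sup>2"
proof -
  let ?c = "exp (- 1 / 2) :: real"
  have g2: "gaussian_rv M (\<lambda>\<omega>. a * X k \<omega> + b * X l \<omega>)" if "k \<in> S" "l \<in> S" for a b k l
  proof -
    have delta: "((if i = k then a else 0) + (if i = l then b else 0)) * X i \<omega>
        = (if i = k then a * X k \<omega> else 0) + (if i = l then b * X l \<omega> else 0)" for i \<omega>
      by (auto simp: algebra_simps)
    have "(\<Sum>i\<in>S. ((if i = k then a else 0) + (if i = l then b else 0)) * X i \<omega>) = a * X k \<omega> + b * X l \<omega>" for \<omega>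
      unfolding delta using that fin by (simp add: sum.distrib)
    then show ?thesis using gauss[of "\<lambda>i. (if i = k then a else 0) + (if i = l then b else 0)"] by simp
  qed
  have g1: "gaussian_rv M (X k)" if "k \<in> S" for k
    using g2[OF that that, of 1 0] by simp
  have meas: "X k \<in> borel_measurable M" if "k \<in> S" for k
    using g1[OF that] by (simp add: gaussian_rv_def)
  have sq: "integrable M (\<lambda>\<omega>. (X k \<omega>)\<^sup>2)" if "k \<in> S" for k
    using centered_gaussian_moments(1)[OF g1 mean] that by blast
  have int: "integrable M (X k)" if "k \<in> S" for k
    using square_integrable_imp_integrable[OF meas sq] that by blast
  have prod: "integrable M (\<lambda>\<omega>. X k \<omega> * X l \<omega>)" if "k \<in> S" "l \<in> S" for k l
    using that by (intro integrable_mult_square_integrable meas sq)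
  define \<rho> where "\<rho> k l = expectation (\<lambda>\<omega>. X k \<omega> * X l \<omega>)" for k l
  have second: "expectation (\<lambda>\<omega>. (X k \<omega> + b * X l \<omega>)\<^sup>2) = 1 + b\<^sup>2 + 2 * b * \<rho> k l"
    if "k \<in> S" "l \<in> S" for b k l
  proof -
    have "(X k \<omega> + b * X l \<omega>)\<^sup>2 = (X k \<omega>)\<^sup>2 + b\<^sup>2 * (X l \<omega>)\<^sup>2 + 2 * b * (X k \<omega> * X l \<omega>)" for \<omega>
      by (simp add: power2_eq_square algebra_simps)
    then show ?thesis using that by (simp add: sq prod var \<rho>_def)
  qed
  have cos_sum: "expectation (\<lambda>\<omega>. cos (X k \<omega> + b * X l \<omega>)) = exp (- (1 + b\<^sup>2 + 2 * b * \<rho> k l) / 2)"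
    if "k \<in> S" "l \<in> S" for b k l
    using centered_gaussian_moments(2)[OF g2[OF that, of 1 b]] second[OF that] that
    by (simp add: int mean)
  have rho: "\<bar>\<rho> k l\<bar> \<le> 1" if "k \<in> S" "l \<in> S" for k l
  proof -
    have "0 \<le> 1 + b\<^sup>2 + 2 * b * \<rho> k l" for b
      unfolding second[OF that, symmetric] by simp
    from this[of 1] this[of "- 1"] show ?thesis by simp
  qed
  have icos: "integrable M (\<lambda>\<omega>. cos (f \<omega>))" if "f \<in> borel_measurable M" for f :: "'a \<Rightarrow> real"
    using that by (intro integrable_const_bound[of _ 1]) auto
  have ecos: "expectation (\<lambda>\<omega>. cos (X k \<omega>)) = ?c" if "k \<in> S" for k
    using cos_sum[OF that that, of 0] by simp
  have ecc: "expectation (\<lambda>\<omega>. cos (X k \<omega>) * cos (X l \<omega>)) \<le> ?c\<^sup>2 + (\<rho> k l)\<^sup>2" 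
    and icc: "integrable M (\<lambda>\<omega>. cos (X k \<omega>) * cos (X l \<omega>))" if "k \<in> S" "l \<in> S" for k l
  proof -
    note [measurable] = meas[OF that(1)] meas[OF that(2)]
    have eq: "cos (X k \<omega>) * cos (X l \<omega>) = (cos (X k \<omega> + (- 1) * X l \<omega>) + cos (X k \<omega> + 1 * X l \<omega>)) / 2" for \<omega>
      by (simp add: cos_times_cos)
    show "integrable M (\<lambda>\<omega>. cos (X k \<omega>) * cos (X l \<omega>))"
      unfolding eq by (intro integrable_divide Bochner_Integration.integrable_add icos) measurable
    have "expectation (\<lambda>\<omega>. cos (X k \<omega>) * cos (X l \<omega>))
        = (expectation (\<lambda>\<omega>. cos (X k \<omega> + (- 1) * X l \<omega>)) + expectation (\<lambda>\<omega>. cos (X k \<omega> + 1 * X l \<omega>))) / 2"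
      unfolding eq
      by (subst integral_divide_zero, subst Bochner_Integration.integral_add) (auto intro!: icos)
    also have "\<dots> = (exp (- 1 + \<rho> k l) + exp (- 1 - \<rho> k l)) / 2"
    proof -
      have "- (1 + (- 1)\<^sup>2 + 2 * (- 1) * \<rho> k l) / 2 = - 1 + \<rho> k l"
        and "- (1 + 1\<^sup>2 + 2 * 1 * \<rho> k l) / 2 = - 1 - \<rho> k l" by (simp_all add: field_simps)
      then show ?thesis by (simp only: cos_sum[OF that])
    qed
    also have "\<dots> = exp (- 1) * ((exp (\<rho> k l) + exp (- \<rho> k l)) / 2)"
      by (simp add: exp_add exp_diff exp_minus field_simps)
    also have "\<dots> \<le> exp (- 1) * (1 + (\<rho> k l)\<^sup>2)"
    proof (rule mult_left_mono)
      show "(exp (\<rho> k l) + exp (- \<rho> k l)) / 2 \<le> 1 + (\<rho> k l)\<^sup>2"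
        using cosh_le_1_plus_square[OF rho[OF that]] by argo
    qed simp
    also have "\<dots> \<le> exp (- 1) + (\<rho> k l)\<^sup>2"
      by (simp add: algebra_simps mult_left_le_one_le)
    also have "exp (- 1) = ?c\<^sup>2" by (simp add: power2_eq_square flip: exp_add)
    finally show "expectation (\<lambda>\<omega>. cos (X k \<omega>) * cos (X l \<omega>)) \<le> ?c\<^sup>2 + (\<rho> k l)\<^sup>2" .
  qed
  let ?N = "real (card S)"
  have N: "0 < ?N" using fin ne by (simp add: card_gt_0_iff)
  have sqeq: "((\<Sum>k\<in>S. cos (X k \<omega>)) / ?N - ?c)\<^sup>2
     = (\<Sum>k\<in>S. \<Sum>l\<in>S. cos (X k \<omega>) * cos (X l \<omega>)) / ?N\<^sup>2 - 2 * ?c / ?N * (\<Sum>k\<in>S. cos (X k \<omega>)) + ?c\<^sup>2" for \<omega>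
    unfolding sum_product[symmetric] using N by (simp add: power2_eq_square field_simps)
  have "expectation (\<lambda>\<omega>. ((\<Sum>k\<in>S. cos (X k \<omega>)) / ?N - ?c)\<^sup>2)
     = (\<Sum>k\<in>S. \<Sum>l\<in>S. expectation (\<lambda>\<omega>. cos (X k \<omega>) * cos (X l \<omega>))) / ?N\<^sup>2
        - 2 * ?c / ?N * (\<Sum>k\<in>S. expectation (\<lambda>\<omega>. cos (X k \<omega>))) + ?c\<^sup>2"
    unfolding sqeq using icc icos[OF meas] by (simp add: prob_space Bochner_Integration.integral_sum)
  also have "\<dots> = (\<Sum>k\<in>S. \<Sum>l\<in>S. expectation (\<lambda>\<omega>. cos (X k \<omega>) * cos (X l \<omega>))) / ?N\<^sup>2 - ?c\<^sup>2"
    using N by (simp add: ecos power2_eq_square)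
  also have "\<dots> \<le> (\<Sum>k\<in>S. \<Sum>l\<in>S. ?c\<^sup>2 + (\<rho> k l)\<^sup>2) / ?N\<^sup>2 - ?c\<^sup>2"
    by (intro diff_right_mono divide_right_mono sum_mono ecc) auto
  also have "\<dots> = (\<Sum>k\<in>S. \<Sum>l\<in>S. (\<rho> k l)\<^sup>2) / ?N\<^sup>2"
    using N by (simp add: sum.distrib add_divide_distrib power2_eq_square)
  finally show ?thesis unfolding \<rho>_def .
qed

section \<open>Rectangular increments of Gaussian processes with product covariance\<close>

text \<open>Expanding the product of the differences gives one term for each choice of an end point in every
  coordinate, that is, one for each vertex of the box.\<close>

lemma rect_increment_prod:
  fixes a b :: "real ^ 'n" and g :: "'n \<Rightarrow> real \<Rightarrow> real"
  assumes "\<And>i. a $ i \<noteq> b $ i"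
  shows "rect_increment (\<lambda>c. \<Prod>i\<in>UNIV. g i (c $ i)) a b = (\<Prod>i\<in>UNIV. g i (b $ i) - g i (a $ i))"
proof -
  have "(\<Prod>i\<in>UNIV. g i (b $ i) - g i (a $ i))
      = (\<Prod>i\<in>UNIV. \<Sum>y\<in>{a $ i, b $ i}. (if y = a $ i then - 1 else 1) * g i y)"
  proof (intro prod.cong refl)
    fix i show "g i (b $ i) - g i (a $ i) = (\<Sum>y\<in>{a $ i, b $ i}. (if y = a $ i then - 1 else 1) * g i y)"
      using assms[of i] by auto
  qed
  also have "\<dots> = (\<Sum>f\<in>PiE UNIV (\<lambda>i. {a $ i, b $ i}). \<Prod>i\<in>UNIV. (if f i = a $ i then - 1 else 1) * g i (f i))"
    by (rule prod_sum_PiE) auto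
  also have "\<dots> = (\<Sum>c | \<forall>i. c $ i \<in> {a $ i, b $ i}. \<Prod>i\<in>UNIV. (if c $ i = a $ i then - 1 else 1) * g i (c $ i))"
    by (rule sum.reindex_bij_witness[of _ vec_nth vec_lambda]) (auto simp: PiE_UNIV_domain)
  also have "\<dots> = rect_increment (\<lambda>c. \<Prod>i\<in>UNIV. g i (c $ i)) a b"
    unfolding rect_increment_def
    by (intro sum.cong refl) (simp add: prod.distrib prod.If_cases)
  finally show ?thesis by simp
qed

lemma finite_box_vertices: "finite {c :: real ^ 'n. \<forall>i. c $ i \<in> {a $ i, b $ i}}"
proof -
  have "{c :: real ^ 'n. \<forall>i. c $ i \<in> {a $ i, b $ i}} = vec_lambda ` PiE UNIV (\<lambda>i. {a $ i, b $ i})"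
  proof (intro equalityI subsetI)
    fix c :: "real ^ 'n" assume "c \<in> {c. \<forall>i. c $ i \<in> {a $ i, b $ i}}"
    then show "c \<in> vec_lambda ` PiE UNIV (\<lambda>i. {a $ i, b $ i})"
      by (intro image_eqI[of _ _ "vec_nth c"]) (auto simp: PiE_UNIV_domain)
  qed (auto simp: PiE_UNIV_domain)
  then show ?thesis by (simp add: finite_PiE)
qed

lemma box_vertices_subset: 
  assumes "\<And>i. a $ i \<le> b $ i"
  shows "{c :: real ^ 'n. \<forall>i. c $ i \<in> {a $ i, b $ i}} \<subseteq> cbox a b"
proof
  fix c assume "c \<in> {c :: real ^ 'n. \<forall>i. c $ i \<in> {a $ i, b $ i}}"
  then have "c $ i = a $ i \<or> c $ i = b $ i" for i by simp
  then have "a $ i \<le> c $ i \<and> c $ i \<le> b $ i" for i using assms[of i] by (metis order_refl)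
  then show "c \<in> cbox a b" by (simp add: mem_box_cart)
qed

lemma gaussian_process_rect_increments:
  fixes a b :: "'k \<Rightarrow> real ^ 'n"
  assumes G: "gaussian_process M T W" and "finite S"
    and ab: "\<And>k i. k \<in> S \<Longrightarrow> a k $ i \<le> b k $ i" and T: "\<And>k. k \<in> S \<Longrightarrow> cbox (a k) (b k) \<subseteq> T"
  shows "gaussian_rv M (\<lambda>\<omega>. \<Sum>k\<in>S. c k * rect_increment (\<lambda>t. W t \<omega>) (a k) (b k))"
proof -
  define V where "V k = {v. \<forall>i. v $ i \<in> {a k $ i, b k $ i}}" for k
  define s where "s k v = (- 1 :: real) ^ card {i. v $ i = a k $ i}" for k v
  define J where "J = (\<Union>k\<in>S. V k)"
  have V: "finite (V k)" for k unfolding V_def by (rule finite_box_vertices)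
  have J: "finite J" "J \<subseteq> T"
    using \<open>finite S\<close> V box_vertices_subset[OF ab] T unfolding J_def V_def by (auto, blast)
  have "(\<Sum>k\<in>S. c k * rect_increment (\<lambda>t. W t \<omega>) (a k) (b k))
      = (\<Sum>t\<in>J. (\<Sum>k\<in>S. c k * (if t \<in> V k then s k t else 0)) * W t \<omega>)" for \<omega>
  proof -
    have "rect_increment (\<lambda>t. W t \<omega>) (a k) (b k) = (\<Sum>t\<in>J. (if t \<in> V k then s k t else 0) * W t \<omega>)"
      if "k \<in> S" for k
    proof -
      have "(\<Sum>t\<in>J. (if t \<in> V k then s k t else 0) * W t \<omega>) = (\<Sum>t\<in>V k. s k t * W t \<omega>)"
        using J(1) that by (intro sum.mono_neutral_cong_right) (auto simp: J_def)
      then show ?thesis by (simp add: rect_increment_def V_def s_def)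
    qed
    then have "(\<Sum>k\<in>S. c k * rect_increment (\<lambda>t. W t \<omega>) (a k) (b k))
      = (\<Sum>k\<in>S. \<Sum>t\<in>J. c k * ((if t \<in> V k then s k t else 0) * W t \<omega>))"
      by (simp add: sum_distrib_left)
    also have "\<dots> = (\<Sum>t\<in>J. (\<Sum>k\<in>S. c k * (if t \<in> V k then s k t else 0)) * W t \<omega>)"
      by (subst sum.swap) (simp add: sum_distrib_right mult.assoc)
    finally show ?thesis .
  qed
  then show ?thesis using G J by (simp add: gaussian_process_def)
qed

text \<open>Taking the covariance of two increments amounts to applying the increment to the covariance kernel in
  each of its two arguments. As the kernel is a product over the coordinates, so is the result, and each factor
  is the mixed second difference of a kernel in one dimension.\<close>

lemma (in prob_space) sheet_rect_increment_moments:
  fixes a b a' b' :: "real ^ 'n" and K :: "'n \<Rightarrow> real \<Rightarrow> real \<Rightarrow> real"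
  assumes G: "gaussian_process M T W" and mean: "\<And>t. t \<in> T \<Longrightarrow> expectation (W t) = 0"
    and cov: "\<And>s t. s \<in> T \<Longrightarrow> t \<in> T \<Longrightarrow>
      expectation (\<lambda>\<omega>. W s \<omega> * W t \<omega>) = (\<Prod>i\<in>UNIV. K i (s $ i) (t $ i))"
    and ab: "\<And>i. a $ i < b $ i" "\<And>i. a' $ i < b' $ i"
    and T: "cbox a b \<subseteq> T" "cbox a' b' \<subseteq> T"
  shows "expectation (\<lambda>\<omega>. rect_increment (\<lambda>t. W t \<omega>) a b) = 0"
    and "expectation (\<lambda>\<omega>. rect_increment (\<lambda>t. W t \<omega>) a b * rect_increment (\<lambda>t. W t \<omega>) a' b')
      = (\<Prod>i\<in>UNIV. K i (b $ i) (b' $ i) - K i (b $ i) (a' $ i) - (K i (a $ i) (b' $ i) - K i (a $ i) (a' $ i)))"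
proof -
  have g: "gaussian_rv M (W t)" if "t \<in> T" for t
    using G[unfolded gaussian_process_def, rule_format, of "{t}" "\<lambda>_. 1"] that by simp
  have meas: "W t \<in> borel_measurable M" if "t \<in> T" for t
    using g[OF that] by (simp add: gaussian_rv_def)
  have sq: "integrable M (\<lambda>\<omega>. (W t \<omega>)\<^sup>2)" if "t \<in> T" for t
    by (rule centered_gaussian_moments(1)[OF g mean]) fact+
  have int: "integrable M (W t)" if "t \<in> T" for t
    using square_integrable_imp_integrable[OF meas sq] that by blast
  have prod: "integrable M (\<lambda>\<omega>. W s \<omega> * W t \<omega>)" if "s \<in> T" "t \<in> T" for s t
    using that by (intro integrable_mult_square_integrable meas sq)
  let ?V = "{c. \<forall>i. c $ i \<in> {a $ i, b $ i}}" and ?V' = "{c. \<forall>i. c $ i \<in> {a' $ i, b' $ i}}"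
  have V: "?V \<subseteq> T" "?V' \<subseteq> T"
    by (rule order_trans[OF box_vertices_subset T(1)] order_trans[OF box_vertices_subset T(2)],
        use ab less_imp_le in blast)+
  show "expectation (\<lambda>\<omega>. rect_increment (\<lambda>t. W t \<omega>) a b) = 0"
    unfolding rect_increment_def using V(1)
    by (subst Bochner_Integration.integral_sum) (auto intro!: sum.neutral simp: int mean subset_iff)
  define s where "s c = (- 1 :: real) ^ card {i. c $ i = a $ i}" for c
  define s' where "s' c = (- 1 :: real) ^ card {i. c $ i = a' $ i}" for c
  have "expectation (\<lambda>\<omega>. rect_increment (\<lambda>t. W t \<omega>) a b * rect_increment (\<lambda>t. W t \<omega>) a' b')
      = expectation (\<lambda>\<omega>. \<Sum>c\<in>?V. \<Sum>e\<in>?V'. s c * s' e * (W c \<omega> * W e \<omega>))"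
    unfolding rect_increment_def sum_product s_def s'_def by (simp add: mult_ac)
  also have "\<dots> = (\<Sum>c\<in>?V. \<Sum>e\<in>?V'. s c * s' e * expectation (\<lambda>\<omega>. W c \<omega> * W e \<omega>))"
  proof -
    have i: "integrable M (\<lambda>\<omega>. s c * s' e * (W c \<omega> * W e \<omega>))" if "c \<in> ?V" "e \<in> ?V'" for c e
      using that V by (intro integrable_mult_right prod) auto
    have "expectation (\<lambda>\<omega>. \<Sum>c\<in>?V. \<Sum>e\<in>?V'. s c * s' e * (W c \<omega> * W e \<omega>))
        = (\<Sum>c\<in>?V. \<Sum>e\<in>?V'. expectation (\<lambda>\<omega>. s c * s' e * (W c \<omega> * W e \<omega>)))"
      using i by (simp add: Bochner_Integration.integral_sum Bochner_Integration.integrable_sum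
          del: mem_Collect_eq)
    then show ?thesis by simp
  qed
  also have "\<dots> = (\<Sum>c\<in>?V. \<Sum>e\<in>?V'. s c * s' e * (\<Prod>i\<in>UNIV. K i (c $ i) (e $ i)))"
    using V by (intro sum.cong refl) (simp add: cov subset_iff)
  also have "\<dots> = rect_increment (\<lambda>c. rect_increment (\<lambda>e. \<Prod>i\<in>UNIV. K i (c $ i) (e $ i)) a' b') a b"
    unfolding rect_increment_def s_def s'_def by (simp add: sum_distrib_left mult_ac)
  also have "\<dots> = rect_increment (\<lambda>c. \<Prod>i\<in>UNIV. K i (c $ i) (b' $ i) - K i (c $ i) (a' $ i)) a b"
    by (subst rect_increment_prod) (use ab(2) less_imp_neq in auto)
  also have "\<dots> = (\<Prod>i\<in>UNIV. K i (b $ i) (b' $ i) - K i (b $ i) (a' $ i) - (K i (a $ i) (b' $ i) - K i (a $ i) (a' $ i)))"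
    by (rule rect_increment_prod[where g="\<lambda>i x. K i x (b' $ i) - K i x (a' $ i)"])
       (use ab(1) less_imp_neq in auto)
  finally show "expectation (\<lambda>\<omega>. rect_increment (\<lambda>t. W t \<omega>) a b * rect_increment (\<lambda>t. W t \<omega>) a' b') = \<dots>" .
qed

section \<open>Autocovariance of fractional Gaussian noise\<close>

text \<open>The autocovariance at lag \<open>x\<close> of fractional Gaussian noise, that is, of the increments of a fractional
  Brownian motion of Hurst index \<open>h\<close> over intervals of length 1.\<close>

definition fgn_autocov :: "real \<Rightarrow> real \<Rightarrow> real" where
  "fgn_autocov h x = (\<bar>x + 1\<bar> powr (2 * h) + \<bar>x - 1\<bar> powr (2 * h) - 2 * \<bar>x\<bar> powr (2 * h)) / 2"

lemma fgn_autocov_minus: "fgn_autocov h (- x) = fgn_autocov h x"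
proof -
  have "\<bar>- x + 1\<bar> = \<bar>x - 1\<bar>" "\<bar>- x - 1\<bar> = \<bar>x + 1\<bar>" by arith+
  then show ?thesis by (simp add: fgn_autocov_def)
qed

lemma fgn_autocov_0: "fgn_autocov h 0 = 1"
  by (simp add: fgn_autocov_def)

text \<open>As a second difference of \<open>x powr (2 * h)\<close>, the autocovariance behaves like a multiple of
  \<open>x powr (2 * h - 2)\<close>. The multiple is 0 in the Brownian case \<open>h = 1 / 2\<close>, where the noise is white.\<close>

lemma fgn_autocov_tendsto_0:
  assumes "0 < h" "h < 1"
  shows "(\<lambda>j. fgn_autocov h (real j)) \<longlonglongrightarrow> 0"
proof -
  have *: "(\<lambda>j::nat. ((real j + 1) powr (2 * h) + (real j - 1) powr (2 * h) - 2 * real j powr (2 * h)) / 2) \<longlonglongrightarrow> 0"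
    (is "?f \<longlonglongrightarrow> 0")
  proof (cases h "1 / 2 :: real" rule: linorder_cases)
    case equal
    have "eventually (\<lambda>j. ?f j = 0) sequentially"
      using eventually_ge_at_top[of 1] by eventually_elim (simp add: equal)
    then show ?thesis by (rule tendsto_eventually)
  qed (use assms in real_asymp)+
  show ?thesis
    by (rule Lim_transform_eventually[OF *]) 
       (auto simp: fgn_autocov_def eventually_sequentially intro!: exI[of _ 1])
qed

text \<open>The terms of \<open>K\<close> that depend on one variable only cancel in the mixed second difference. What remains
  depends on \<open>x - y\<close> and, by self-similarity, scales with the mesh \<open>1 / m\<close>.\<close>

lemma fbm_kernel_increment:
  fixes h m x y :: real
  assumes m: "m > 0"
  defines "K \<equiv> \<lambda>s t. (s powr (2 * h) + t powr (2 * h) - \<bar>s - t\<bar> powr (2 * h)) / 2"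
  shows "K ((x + 1) / m) ((y + 1) / m) - K ((x + 1) / m) (y / m)
          - (K (x / m) ((y + 1) / m) - K (x / m) (y / m))
       = (m powr (- h))\<^sup>2 * fgn_autocov h (x - y)"
proof -
  have scale: "\<bar>s / m - t / m\<bar> powr (2 * h) = (m powr (- h))\<^sup>2 * \<bar>s - t\<bar> powr (2 * h)" for s t
    using m by (simp add: powr_divide powr_minus field_simps abs_divide power2_eq_square
      flip: diff_divide_distrib powr_add)
  have shift: "x + 1 - (y + 1) = x - y" "x + 1 - y = x - y + 1" "x - (y + 1) = x - y - 1" by simp_all
  show ?thesis
    unfolding K_def scale fgn_autocov_def shift by argo
qed

lemma cesaro_tendsto_0:
  fixes a :: "nat \<Rightarrow> real"
  assumes lim: "a \<longlonglongrightarrow> 0" and nonneg: "\<And>j. 0 \<le> a j"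
  shows "(\<lambda>n. (\<Sum>j<n. a j) / real n) \<longlonglongrightarrow> 0"
proof (rule LIMSEQ_I)
  fix e :: real assume e: "0 < e"
  obtain N where N: "\<And>j. j \<ge> N \<Longrightarrow> a j < e / 2"
    using LIMSEQ_D[OF lim, of "e / 2"] e nonneg by auto
  define C where "C = (\<Sum>j<N. a j)"
  have C: "0 \<le> C" unfolding C_def by (intro sum_nonneg nonneg)
  obtain n0 :: nat where n0: "2 * C / e < real n0" using reals_Archimedean2 by blast
  show "\<exists>n0. \<forall>n\<ge>n0. norm ((\<Sum>j<n. a j) / real n - 0) < e"
  proof (intro exI[of _ "max n0 (Suc N)"] allI impI)
    fix n assume n: "max n0 (Suc N) \<le> n"
    have "(\<Sum>j<n. a j) = C + (\<Sum>j\<in>{N..<n}. a j)"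
      using n sum.atLeastLessThan_concat[of 0 N n a] by (simp add: C_def atLeast0LessThan)
    also have "(\<Sum>j\<in>{N..<n}. a j) \<le> (\<Sum>j\<in>{N..<n}. e / 2)"
      using N by (intro sum_mono) (auto intro: less_imp_le)
    also have "\<dots> \<le> real n * (e / 2)" using e by simp
    also have "C < real n * (e / 2)"
    proof -
      have "2 * C / e < real n" using n0 n by linarith
      then show ?thesis using e by (simp add: field_simps)
    qed
    finally have "(\<Sum>j<n. a j) < e * real n" by (simp add: mult.commute)
    moreover have "0 \<le> (\<Sum>j<n. a j)" by (intro sum_nonneg nonneg)
    ultimately show "norm ((\<Sum>j<n. a j) / real n - 0) < e"
      using n by (simp add: divide_less_eq)
  qed
qed

lemma sum_fgn_autocov_square_le:
  assumes "l < m"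
  shows "(\<Sum>k<m. (fgn_autocov h (real k - real l))\<^sup>2) \<le> 2 * (\<Sum>j<m. (fgn_autocov h (real j))\<^sup>2)"
proof -
  let ?g = "\<lambda>j. (fgn_autocov h (real j))\<^sup>2"
  have "(\<Sum>k<m. (fgn_autocov h (real k - real l))\<^sup>2)
      = (\<Sum>k\<in>{..<l}. (fgn_autocov h (real k - real l))\<^sup>2) + (\<Sum>k\<in>{l..<m}. (fgn_autocov h (real k - real l))\<^sup>2)"
    using assms sum.atLeastLessThan_concat[of 0 l m "\<lambda>k. (fgn_autocov h (real k - real l))\<^sup>2"]
    by (simp add: atLeast0LessThan)
  also have "(\<Sum>k\<in>{..<l}. (fgn_autocov h (real k - real l))\<^sup>2) = (\<Sum>j\<in>{1..l}. ?g j)"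
  proof (rule sum.reindex_bij_witness[of _ "\<lambda>j. l - j" "\<lambda>k. l - k"])
    fix k assume "k \<in> {..<l}"
    then show "?g (l - k) = (fgn_autocov h (real k - real l))\<^sup>2"
      using fgn_autocov_minus[of h "real k - real l"] by (simp add: of_nat_diff)
  qed auto
  also have "\<dots> \<le> (\<Sum>j<m. ?g j)"
    using assms by (intro sum_mono2) auto
  also have "(\<Sum>k\<in>{l..<m}. (fgn_autocov h (real k - real l))\<^sup>2) = (\<Sum>j\<in>{..<m - l}. ?g j)"
    by (rule sum.reindex_bij_witness[of _ "\<lambda>j. j + l" "\<lambda>k. k - l"]) (auto simp: of_nat_diff)
  also have "\<dots> \<le> (\<Sum>j<m. ?g j)"
    by (intro sum_mono2) auto
  finally show ?thesis by simp
qed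

section \<open>Chargeable functions on a thin layer of cubes\<close>

text \<open>Cubes of side \<open>1 / m\<close> in the grid are addressed by their lower corner in units of \<open>1 / m\<close>. Only one layer of
  the grid is used, the one touching the face \<open>x $ i0 = 0\<close> of the unit cube: it has \<open>m ^ (d - 1)\<close> cubes,
  few enough to keep the perimeter of their unions bounded.\<close>

definition slab_index :: "'n::finite \<Rightarrow> nat \<Rightarrow> ('n \<Rightarrow> nat) set" where
  "slab_index i0 m = PiE UNIV (\<lambda>i. if i = i0 then {0} else {..<m})"

definition cell_lo :: "nat \<Rightarrow> ('n \<Rightarrow> nat) \<Rightarrow> real ^ 'n" where
  "cell_lo m k = (\<chi> i. real (k i) / real m)"

definition cell_hi :: "nat \<Rightarrow> ('n \<Rightarrow> nat) \<Rightarrow> real ^ 'n" where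
  "cell_hi m k = (\<chi> i. (real (k i) + 1) / real m)"

abbreviation cell :: "nat \<Rightarrow> ('n \<Rightarrow> nat) \<Rightarrow> (real ^ 'n) set" where
  "cell m k \<equiv> cbox (cell_lo m k) (cell_hi m k)"

lemma finite_slab_index: "finite (slab_index i0 m)"
  unfolding slab_index_def by (intro finite_PiE) auto

lemma card_slab_index: "card (slab_index (i0 :: 'n::finite) m) = m ^ (CARD('n) - 1)"
proof -
  have "card (slab_index i0 m) = (\<Prod>i\<in>UNIV. card (if i = i0 then {0} else {..<m}))"
    unfolding slab_index_def by (rule card_PiE) simp
  also have "\<dots> = (\<Prod>i\<in>UNIV - {i0}. m)"
    by (subst prod.remove[of _ i0]) (auto intro!: prod.cong)
  finally show ?thesis by (simp add: card_Diff_singleton)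
qed

lemma cell_lo_less_cell_hi: "m > 0 \<Longrightarrow> cell_lo m k $ i < cell_hi m k $ i"
  by (simp add: cell_lo_def cell_hi_def divide_strict_right_mono)

lemma cell_subset_unit_cube:
  assumes "k \<in> slab_index i0 m" "m > 0"
  shows "cell m k \<subseteq> unit_cube"
proof -
  have "k i < m" for i
    using assms by (auto simp: slab_index_def PiE_UNIV_domain split: if_splits)
  then have "real (k i) + 1 \<le> real m" for i by (metis Suc_leI of_nat_Suc of_nat_le_iff add.commute)
  then have "0 \<le> cell_lo m k $ i" "cell_hi m k $ i \<le> 1" for i
    using assms(2) by (auto simp: cell_lo_def cell_hi_def)
  then show ?thesis
    unfolding subset_iff mem_box_cart zero_index one_index by (meson order_trans)
qed

lemma negligible_cell_Int_cell:
  fixes k l :: "'n::finite \<Rightarrow> nat"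
  assumes "k \<noteq> l" "m > 0"
  shows "negligible (cell m k \<inter> cell m l)"
proof -
  have less: "negligible (cell m k \<inter> cell m l)" if "k i < l i" for k l :: "'n \<Rightarrow> nat" and i
  proof (rule negligible_subset)
    have "{x :: real ^ 'n. x $ i = real (l i) / real m} = {x. x \<bullet> axis i 1 = real (l i) / real m}"
      by (simp add: cart_eq_inner_axis)
    then show "negligible {x :: real ^ 'n. x $ i = real (l i) / real m}"
      by (simp add: negligible_standard_hyperplane axis_in_Basis_iff)
    show "cell m k \<inter> cell m l \<subseteq> {x. x $ i = real (l i) / real m}"
    proof
      fix x assume "x \<in> cell m k \<inter> cell m l"
      then have "x $ i \<le> (real (k i) + 1) / real m" "real (l i) / real m \<le> x $ i"
        by (auto simp: mem_box_cart cell_lo_def cell_hi_def)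
      moreover have "(real (k i) + 1) / real m \<le> real (l i) / real m"
        using that by (intro divide_right_mono) auto
      ultimately show "x \<in> {x. x $ i = real (l i) / real m}" by simp
    qed
  qed
  obtain i where "k i \<noteq> l i" using assms(1) by blast
  then consider "k i < l i" | "l i < k i" by linarith
  then show ?thesis
  proof cases
    case 1
    then show ?thesis by (rule less)
  next
    case 2
    then show ?thesis by (subst Int_commute) (rule less)
  qed
qed

text \<open>Each of the at most \<open>m ^ (d - 1)\<close> cubes has \<open>2 d\<close> faces, of area \<open>1 / m ^ (d - 1)\<close> each.\<close>

lemma perimeter_slab_le:
  fixes i0 :: "'n::finite"
  assumes A: "A \<subseteq> slab_index i0 m" and m: "m > 0"
  shows "perimeter (\<Union>k\<in>A. cell m k) \<le> ereal (2 * CARD('n))"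
proof -
  have fin: "finite A" using A finite_slab_index finite_subset by blast
  have side: "cell_hi m k $ j - cell_lo m k $ j = 1 / real m" for k j
    by (simp add: cell_lo_def cell_hi_def flip: diff_divide_distrib)
  have "perimeter (\<Union>k\<in>A. cell m k)
      \<le> ereal (\<Sum>k\<in>A. 2 * (\<Sum>i\<in>UNIV. \<Prod>j\<in>UNIV - {i}. cell_hi m k $ j - cell_lo m k $ j))"
    using m by (intro perimeter_almost_disjoint_boxes_le fin negligible_cell_Int_cell
        less_imp_le[OF cell_lo_less_cell_hi])
  also have "(\<Sum>k\<in>A. 2 * (\<Sum>i\<in>UNIV. \<Prod>j\<in>UNIV - {i}. cell_hi m k $ j - cell_lo m k $ j))
      = real (card A) * (2 * CARD('n) * (1 / real m) ^ (CARD('n) - 1))"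
    unfolding side by (simp add: card_Diff_singleton)
  also have "\<dots> \<le> real (m ^ (CARD('n) - 1)) * (2 * CARD('n) * (1 / real m) ^ (CARD('n) - 1))"
    using card_mono[OF finite_slab_index A] card_slab_index[of i0 m]
    by (intro mult_right_mono) (auto simp flip: of_nat_power)
  also have "\<dots> = 2 * CARD('n)" using m by (simp add: power_divide)
  finally show ?thesis by simp
qed

lemma measure_slab_le:
  fixes i0 :: "'n::finite"
  assumes A: "A \<subseteq> slab_index i0 m" and m: "m > 0"
  shows "measure lebesgue (\<Union>k\<in>A. cell m k) \<le> 1 / real m"
proof -
  have fin: "finite A" using A finite_slab_index finite_subset by blast
  have vol: "measure lebesgue (cell m k) = (1 / real m) ^ CARD('n)" for k :: "'n \<Rightarrow> nat"
  proof -
    have "cell m k \<noteq> {}"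
      using cell_lo_less_cell_hi[OF m, of k] by (auto simp: interval_ne_empty_cart intro: less_imp_le)
    moreover have "cell_hi m k $ j - cell_lo m k $ j = 1 / real m" for j
      by (simp add: cell_lo_def cell_hi_def flip: diff_divide_distrib)
    ultimately show ?thesis by (simp add: content_cbox_cart)
  qed
  have "measure lebesgue (\<Union>k\<in>A. cell m k) \<le> (\<Sum>k\<in>A. measure lebesgue (cell m k))"
    by (intro measure_UNION_le fin) auto
  also have "\<dots> = real (card A) * (1 / real m) ^ CARD('n)"
    by (simp add: vol)
  also have "\<dots> \<le> real (m ^ (CARD('n) - 1)) * (1 / real m) ^ CARD('n)"
    using card_mono[OF finite_slab_index A] card_slab_index[of i0 m]
    by (intro mult_right_mono) (auto simp flip: of_nat_power)
  also have "\<dots> = 1 / real m"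
    using m by (simp add: power_divide power_eq_if[of _ "CARD('n)"])
  finally show ?thesis .
qed

lemma figure_increment_Union_cells:
  assumes G: "figure_increment f G" and m: "m > 0" and A: "A \<subseteq> slab_index i0 m"
  shows "figure (\<Union>k\<in>A. cell m k)"
    and "G (\<Union>k\<in>A. cell m k) = (\<Sum>k\<in>A. rect_increment f (cell_lo m k) (cell_hi m k))"
proof -
  have fin: "finite A" using A finite_slab_index finite_subset by blast
  have rect: "rectangle (cell m k)" if "k \<in> A" for k
    using that A m cell_lo_less_cell_hi cell_subset_unit_cube unfolding rectangle_def by blast
  have fig: "figure (\<Union>k\<in>B. cell m k)" if "B \<subseteq> A" for B
    using that finite_subset[OF that fin] rect unfolding figure_def
    by (intro exI[of _ "cell m ` B"]) auto
  then show "figure (\<Union>k\<in>A. cell m k)" by simp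
  have add: "G (F1 \<union> F2) = G F1 + G F2" if "figure F1" "figure F2" "negligible (F1 \<inter> F2)" for F1 F2
    using G that unfolding figure_increment_def by blast
  show "G (\<Union>k\<in>A. cell m k) = (\<Sum>k\<in>A. rect_increment f (cell_lo m k) (cell_hi m k))"
    using fin subset_refl[of A]
  proof (induction rule: finite_subset_induct')
    case empty
    then show ?case using add[of "{}" "{}"] fig[of "{}"] by simp
  next
    case (insert k B)
    have "negligible (cell m k \<inter> (\<Union>l\<in>B. cell m l))"
      unfolding Int_UN_distrib using insert.hyps fin m
      by (intro negligible_Union finite_imageI) (auto intro: negligible_cell_Int_cell)
    then have "G (cell m k \<union> (\<Union>l\<in>B. cell m l)) = G (cell m k) + G (\<Union>l\<in>B. cell m l)"
      using fig[of "{k}"] fig[of B] insert.hyps by (intro add) auto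
    moreover have "G (cell m k) = rect_increment f (cell_lo m k) (cell_hi m k)"
    proof -
      have "k \<in> slab_index i0 m" using insert.hyps A by blast
      from cell_subset_unit_cube[OF this m] show ?thesis
        using G[unfolded figure_increment_def, THEN conjunct1, rule_format, of "cell_lo m k" "cell_hi m k"]
          cell_lo_less_cell_hi[OF m, of k] by simp
    qed
    ultimately show ?case using insert by simp
  qed
qed

text \<open>Unions of cubes in the thinner and thinner layers BV-converge to the empty set, whichever cubes are taken,
  and the charge of such a union is the sum of the increments over its cubes.\<close>

lemma chargeable_sum_rect_increment_tendsto_0:
  fixes i0 :: "'n::finite" and A :: "nat \<Rightarrow> ('n \<Rightarrow> nat) set"
  assumes f: "chargeable f" and A: "\<And>n. A n \<subseteq> slab_index i0 (Suc n)"
  shows "(\<lambda>n. \<Sum>k\<in>A n. rect_increment f (cell_lo (Suc n) k) (cell_hi (Suc n) k)) \<longlonglongrightarrow> 0"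
proof -
  obtain G \<mu> where G: "figure_increment f G" and \<mu>: "charge \<mu>" and ext: "\<And>F. figure F \<Longrightarrow> \<mu> F = G F"
    using f by (auto simp: chargeable_def)
  define B where "B n = (\<Union>k\<in>A n. cell (Suc n) k)" for n
  have fig: "figure (B n)" for n
    using figure_increment_Union_cells(1)[OF G zero_less_Suc A] by (simp add: B_def)
  have empty: "BV_subset ({} :: (real ^ 'n) set)"
    using perimeter_slab_le[of "{}" i0 1] by (auto simp: BV_subset_def)
  have per: "perimeter (B n) \<le> ereal (2 * CARD('n))" for n
    unfolding B_def by (rule perimeter_slab_le[OF A]) simp
  have "BV_converges B {}"
    unfolding BV_converges_def
  proof (intro conjI allI empty)
    show "BV_subset (B n)" for n
      unfolding BV_subset_def
    proof (intro conjI)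
      show "B n \<in> sets lebesgue"
        using finite_subset[OF A finite_slab_index] unfolding B_def by (intro sets.finite_UN) auto
      show "B n \<subseteq> unit_cube"
        using cell_subset_unit_cube A unfolding B_def by blast
      show "perimeter (B n) < \<infinity>" using per[of n] by (rule le_less_trans) simp
    qed
    have "(SUP n. perimeter (B n)) \<le> ereal (2 * CARD('n))" by (intro SUP_least per)
    then show "(SUP n. perimeter (B n)) < \<infinity>" by (rule le_less_trans) simp
    show "(\<lambda>n. measure lebesgue (B n - {} \<union> ({} - B n))) \<longlonglongrightarrow> 0"
    proof (rule tendsto_sandwich[OF _ _ tendsto_const])
      show "(\<lambda>n. 1 / real (Suc n)) \<longlonglongrightarrow> 0"
        by (rule LIMSEQ_Suc) (rule lim_const_over_n)
      show "\<forall>\<^sub>F n in sequentially. measure lebesgue (B n - {} \<union> ({} - B n)) \<le> 1 / real (Suc n)"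
        using measure_slab_le[OF A zero_less_Suc] by (simp add: B_def)
    qed simp
  qed
  then have "(\<lambda>n. \<mu> (B n)) \<longlonglongrightarrow> \<mu> {}" using \<mu> by (simp add: charge_def)
  moreover have "\<mu> {} = 0"
    using figure_increment_Union_cells[OF G zero_less_one, of "{}" i0] ext[of "{}"] by simp
  moreover have "\<mu> (B n) = (\<Sum>k\<in>A n. rect_increment f (cell_lo (Suc n) k) (cell_hi (Suc n) k))" for n
    using figure_increment_Union_cells(2)[OF G zero_less_Suc A] ext[OF fig] by (simp add: B_def)
  ultimately show ?thesis by simp
qed

text \<open>The selection of the cubes may depend on \<open>f\<close>: taking the cubes on which the increment is nonnegative, and then
  the others, gives control of the absolute values.\<close>

lemma chargeable_sum_abs_rect_increment_tendsto_0:
  fixes i0 :: "'n::finite"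
  assumes f: "chargeable f"
  shows "(\<lambda>n. \<Sum>k\<in>slab_index i0 (Suc n). \<bar>rect_increment f (cell_lo (Suc n) k) (cell_hi (Suc n) k)\<bar>) \<longlonglongrightarrow> 0"
proof -
  define D where "D n k = rect_increment f (cell_lo (Suc n) k) (cell_hi (Suc n) k)" for n k
  define P where "P n = {k \<in> slab_index i0 (Suc n). 0 \<le> D n k}" for n
  define Q where "Q n = {k \<in> slab_index i0 (Suc n). D n k < 0}" for n
  have "(\<lambda>n. (\<Sum>k\<in>P n. D n k) - (\<Sum>k\<in>Q n. D n k)) \<longlonglongrightarrow> 0 - 0"
    unfolding D_def
    by (intro tendsto_diff chargeable_sum_rect_increment_tendsto_0[OF f]) (auto simp: P_def Q_def)
  moreover have "(\<Sum>k\<in>P n. D n k) - (\<Sum>k\<in>Q n. D n k) = (\<Sum>k\<in>slab_index i0 (Suc n). \<bar>D n k\<bar>)" for n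
  proof -
    have "slab_index i0 (Suc n) = P n \<union> Q n" by (auto simp: P_def Q_def)
    moreover have "finite (P n)" "finite (Q n)" "P n \<inter> Q n = {}"
      using finite_slab_index[of i0 "Suc n"] by (auto simp: P_def Q_def)
    ultimately have "(\<Sum>k\<in>slab_index i0 (Suc n). \<bar>D n k\<bar>) = (\<Sum>k\<in>P n. \<bar>D n k\<bar>) + (\<Sum>k\<in>Q n. \<bar>D n k\<bar>)"
      by (simp add: sum.union_disjoint)
    also have "(\<Sum>k\<in>P n. \<bar>D n k\<bar>) = (\<Sum>k\<in>P n. D n k)" by (intro sum.cong) (auto simp: P_def)
    also have "(\<Sum>k\<in>Q n. \<bar>D n k\<bar>) = - (\<Sum>k\<in>Q n. D n k)"
      unfolding sum_negf[symmetric] by (intro sum.cong) (auto simp: Q_def)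
    finally show ?thesis by simp
  qed
  ultimately show ?thesis by (simp add: D_def)
qed

section \<open>Increments of the fractional Brownian sheet\<close>

lemma (in prob_space) sheet_cell_increment_moments:
  fixes W :: "real ^ 'n \<Rightarrow> 'a \<Rightarrow> real"
  assumes W: "fractional_brownian_sheet M H W" and m: "m > 0"
    and kl: "k \<in> slab_index i0 m" "l \<in> slab_index i0 m"
  shows "expectation (\<lambda>\<omega>. rect_increment (\<lambda>t. W t \<omega>) (cell_lo m k) (cell_hi m k)) = 0"
    and "expectation (\<lambda>\<omega>. rect_increment (\<lambda>t. W t \<omega>) (cell_lo m k) (cell_hi m k) *
                         rect_increment (\<lambda>t. W t \<omega>) (cell_lo m l) (cell_hi m l))
      = (\<Prod>i\<in>UNIV. real m powr (- (H $ i)))\<^sup>2 *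
        (\<Prod>i\<in>UNIV. fgn_autocov (H $ i) (real (k i) - real (l i)))"
proof -
  define K where "K i s t = (s powr (2 * H $ i) + t powr (2 * H $ i) - \<bar>s - t\<bar> powr (2 * H $ i)) / 2" for i s t
  have G: "gaussian_process M unit_cube W"
    and mean: "\<And>t. t \<in> unit_cube \<Longrightarrow> expectation (W t) = 0"
    and cov: "\<And>s t. s \<in> unit_cube \<Longrightarrow> t \<in> unit_cube \<Longrightarrow>
      expectation (\<lambda>\<omega>. W s \<omega> * W t \<omega>) = (\<Prod>i\<in>UNIV. K i (s $ i) (t $ i))"
    using W by (auto simp: fractional_brownian_sheet_def K_def)
  have lt: "cell_lo m p $ i < cell_hi m p $ i" for p and i :: 'n
    using m by (rule cell_lo_less_cell_hi)
  have cube: "cell m k \<subseteq> unit_cube" "cell m l \<subseteq> unit_cube"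
    using kl m by (auto intro!: cell_subset_unit_cube del: subsetI)
  show "expectation (\<lambda>\<omega>. rect_increment (\<lambda>t. W t \<omega>) (cell_lo m k) (cell_hi m k)) = 0"
    by (rule sheet_rect_increment_moments(1)[where T = unit_cube and K = K, OF G mean cov lt lt cube])
  have "expectation (\<lambda>\<omega>. rect_increment (\<lambda>t. W t \<omega>) (cell_lo m k) (cell_hi m k) *
                         rect_increment (\<lambda>t. W t \<omega>) (cell_lo m l) (cell_hi m l))
      = (\<Prod>i\<in>UNIV. K i (cell_hi m k $ i) (cell_hi m l $ i) - K i (cell_hi m k $ i) (cell_lo m l $ i)
          - (K i (cell_lo m k $ i) (cell_hi m l $ i) - K i (cell_lo m k $ i) (cell_lo m l $ i)))"
    by (rule sheet_rect_increment_moments(2)[where T = unit_cube and K = K, OF G mean cov lt lt cube])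
  also have "\<dots> = (\<Prod>i\<in>UNIV. (real m powr (- (H $ i)))\<^sup>2 * fgn_autocov (H $ i) (real (k i) - real (l i)))"
    unfolding K_def cell_lo_def cell_hi_def vec_lambda_beta
    using m by (intro prod.cong refl fbm_kernel_increment) simp
  also have "\<dots> = (\<Prod>i\<in>UNIV. real m powr (- (H $ i)))\<^sup>2 *
        (\<Prod>i\<in>UNIV. fgn_autocov (H $ i) (real (k i) - real (l i)))"
    by (simp add: prod.distrib prod_power_distrib)
  finally show "expectation (\<lambda>\<omega>. rect_increment (\<lambda>t. W t \<omega>) (cell_lo m k) (cell_hi m k) *
                         rect_increment (\<lambda>t. W t \<omega>) (cell_lo m l) (cell_hi m l)) = \<dots>" .
qed

text \<open>The mean square correlation of the normalized increments of the sheet over the cubes of the layer. The sum over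
  one index factorizes over the coordinates; coordinate \<open>i0\<close> is constant on the layer and contributes the factor 1.
  Each remaining factor is a Cesaro mean of squared autocovariances, which tends to 0 as \<open>m\<close> grows.\<close>

lemma slab_mean_square_correlation_le:
  fixes i0 :: "'n::finite" and h :: "'n \<Rightarrow> real"
  assumes m: "m > 0"
  shows "(\<Sum>k\<in>slab_index i0 m. \<Sum>l\<in>slab_index i0 m.
            (\<Prod>i\<in>UNIV. fgn_autocov (h i) (real (k i) - real (l i)))\<^sup>2) / (real (card (slab_index i0 m)))\<^sup>2
       \<le> (\<Prod>i\<in>UNIV - {i0}. 2 * ((\<Sum>j<m. (fgn_autocov (h i) (real j))\<^sup>2) / real m))"
proof -
  let ?S = "slab_index i0 m" and ?d = "CARD('n) - 1"
  let ?B = "\<lambda>i. if i = i0 then {0} else {..<m}"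
  let ?R = "\<Prod>i\<in>UNIV - {i0}. 2 * (\<Sum>j<m. (fgn_autocov (h i) (real j))\<^sup>2)"
  have row: "(\<Sum>k\<in>?S. (\<Prod>i\<in>UNIV. fgn_autocov (h i) (real (k i) - real (l i)))\<^sup>2) \<le> ?R" if l: "l \<in> ?S" for l
  proof -
    have lB: "l i \<in> ?B i" for i
      using l unfolding slab_index_def by (rule PiE_mem) simp
    have l0: "l i0 = 0" using lB[of i0] by simp
    have lm: "l i < m" if "i \<in> UNIV - {i0}" for i using lB[of i] that by simp
    have "(\<Sum>k\<in>?S. (\<Prod>i\<in>UNIV. fgn_autocov (h i) (real (k i) - real (l i)))\<^sup>2)
        = (\<Prod>i\<in>UNIV. \<Sum>a\<in>?B i. (fgn_autocov (h i) (real a - real (l i)))\<^sup>2)"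
      unfolding slab_index_def prod_power_distrib by (rule prod_sum_PiE[symmetric]) auto
    also have "\<dots> = (\<Prod>i\<in>UNIV - {i0}. \<Sum>a<m. (fgn_autocov (h i) (real a - real (l i)))\<^sup>2)"
      by (subst prod.remove[of _ i0]) (auto simp: l0 fgn_autocov_0 intro!: prod.cong)
    also have "\<dots> \<le> ?R"
      by (intro prod_mono conjI sum_nonneg sum_fgn_autocov_square_le lm) auto
    finally show ?thesis .
  qed
  have "(\<Sum>k\<in>?S. \<Sum>l\<in>?S. (\<Prod>i\<in>UNIV. fgn_autocov (h i) (real (k i) - real (l i)))\<^sup>2)
      \<le> (\<Sum>l\<in>?S. ?R)"
    by (subst sum.swap) (intro sum_mono row)
  also have "\<dots> = real m ^ ?d * ?R" by (simp add: card_slab_index)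
  finally have "(\<Sum>k\<in>?S. \<Sum>l\<in>?S. (\<Prod>i\<in>UNIV. fgn_autocov (h i) (real (k i) - real (l i)))\<^sup>2)
       / (real (card ?S))\<^sup>2 \<le> real m ^ ?d * ?R / (real m ^ ?d)\<^sup>2"
    by (simp add: card_slab_index divide_right_mono)
  also have "\<dots> = ?R / (\<Prod>i\<in>UNIV - {i0}. real m)"
    using m by (simp add: power2_eq_square card_Diff_singleton)
  also have "\<dots> = (\<Prod>i\<in>UNIV - {i0}. 2 * ((\<Sum>j<m. (fgn_autocov (h i) (real j))\<^sup>2) / real m))"
    unfolding prod_dividef[symmetric] by simp
  finally show ?thesis .
qed

lemma one_minus_cos_le_abs: "1 - cos x \<le> \<bar>x :: real\<bar>"
proof -
  have "1 - cos x = 2 * (\<bar>sin (x / 2)\<bar> * \<bar>sin (x / 2)\<bar>)"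
    using cos_double_sin[of "x / 2"] by (simp add: power2_eq_square)
  also have "\<dots> \<le> 2 * (\<bar>x / 2\<bar> * 1)"
    by (intro mult_left_mono mult_mono abs_sin_x_le_abs_x) auto
  finally show ?thesis by simp
qed

theorem theorem10p6:
  fixes H :: "real ^ 'n"
    and M :: "'a measure"
    and W :: "real ^ 'n \<Rightarrow> 'a \<Rightarrow> real"
  assumes "prob_space M"
    and "\<And>i. 0 < H $ i \<and> H $ i < 1"
    and "fractional_brownian_sheet M H W"
    and "\<And>\<omega>. \<omega> \<in> space M \<Longrightarrow> (\<lambda>t. W t \<omega>) \<in> C0_cube"
    and "(\<Sum>i\<in>UNIV. H $ i) / real CARD('n) \<le> (real CARD('n) - 1) / real CARD('n)"
  shows "AE \<omega> in M. \<not> chargeable (\<lambda>t. W t \<omega>)"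
proof -
  interpret prob_space M by fact
  have H: "0 < H $ i" "H $ i < 1" for i using assms(2) by auto
  have G: "gaussian_process M unit_cube W"
    using assms(3) by (simp add: fractional_brownian_sheet_def)
  \<comment> \<open>Positive Hurst indices force the dimension to be at least 2, so that the layer has a free
    coordinate along which correlations decay.\<close>
  have sumH: "(\<Sum>i\<in>UNIV. H $ i) \<le> real CARD('n) - 1"
    using assms(5) by (simp add: divide_le_cancel)
  have "0 < (\<Sum>i\<in>UNIV. H $ i)" using H by (intro sum_pos) auto
  then have dim: "CARD('n) > 1" using sumH by simp
  obtain i0 :: 'n where True by blast
  have ne: "UNIV - {i0} \<noteq> {}"
    using dim card_Diff_singleton[of i0 UNIV] by (metis UNIV_I card.empty zero_less_diff less_irrefl)
  let ?c = "exp (- 1 / 2) :: real"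
  \<comment> \<open>\<open>Suc n\<close> instead of \<open>n\<close>, because the grid needs a positive number of cubes per side.\<close>
  define S where "S n = slab_index i0 (Suc n)" for n
  define D where "D n k \<omega> = rect_increment (\<lambda>t. W t \<omega>) (cell_lo (Suc n) k) (cell_hi (Suc n) k)" for n k \<omega>
  define \<sigma> where "\<sigma> n = (\<Prod>i\<in>UNIV. real (Suc n) powr (- (H $ i)))" for n
  define X where "X n k \<omega> = D n k \<omega> / \<sigma> n" for n k \<omega>
  define Y where "Y n \<omega> = (\<Sum>k\<in>S n. cos (X n k \<omega>)) / card (S n)" for n \<omega>
  have S: "finite (S n)" "real (card (S n)) = real (Suc n) ^ (CARD('n) - 1)" "S n \<noteq> {}" for n
    using finite_slab_index[of i0 "Suc n"] card_slab_index[of i0 "Suc n"] unfolding S_def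
    by (simp, simp, metis card.empty nat.distinct(1) power_not_zero)
  have N: "0 < real (card (S n))" for n using S(2)[of n] by simp
  have \<sigma>: "0 < \<sigma> n" for n unfolding \<sigma>_def by (intro prod_pos) simp
  have cube: "cell (Suc n) k \<subseteq> unit_cube" if "k \<in> S n" for n k
    using that cell_subset_unit_cube unfolding S_def by blast
  have meanX: "expectation (X n k) = 0" if "k \<in> S n" for n k
    using sheet_cell_increment_moments(1)[OF assms(3) zero_less_Suc] that
    by (simp add: X_def[abs_def] D_def S_def)
  have covX: "expectation (\<lambda>\<omega>. X n k \<omega> * X n l \<omega>)
      = (\<Prod>i\<in>UNIV. fgn_autocov (H $ i) (real (k i) - real (l i)))" if "k \<in> S n" "l \<in> S n" for n k l
  proof -
    have "expectation (\<lambda>\<omega>. D n k \<omega> * D n l \<omega>)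
        = (\<sigma> n)\<^sup>2 * (\<Prod>i\<in>UNIV. fgn_autocov (H $ i) (real (k i) - real (l i)))"
      using that unfolding D_def \<sigma>_def S_def
      by (intro sheet_cell_increment_moments(2)[OF assms(3) zero_less_Suc])
    then show ?thesis using \<sigma>[of n] by (simp add: X_def power2_eq_square)
  qed
  have varX: "expectation (\<lambda>\<omega>. (X n k \<omega>)\<^sup>2) = 1" if "k \<in> S n" for n k
    using covX[OF that that] by (simp add: power2_eq_square fgn_autocov_0)
  have gaussX: "gaussian_rv M (\<lambda>\<omega>. \<Sum>k\<in>S n. c k * X n k \<omega>)" for n c
  proof -
    have "gaussian_rv M (\<lambda>\<omega>. \<Sum>k\<in>S n. c k / \<sigma> n * rect_increment (\<lambda>t. W t \<omega>) (cell_lo (Suc n) k) (cell_hi (Suc n) k))"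
      by (rule gaussian_process_rect_increments[OF G S(1)])
         (simp_all add: cell_lo_less_cell_hi less_imp_le cube)
    then show ?thesis by (simp add: X_def D_def)
  qed
  have measX: "X n k \<in> borel_measurable M" if "k \<in> S n" for n k
  proof -
    have "(\<Sum>l\<in>S n. (if l = k then 1 else 0) * X n l \<omega>) = X n k \<omega>" for \<omega>
      using that S(1) by (simp add: if_distrib[of "\<lambda>z. z * _"] cong: if_cong)
    then show ?thesis using gaussX[of "\<lambda>l. if l = k then 1 else 0" n] by (simp add: gaussian_rv_def)
  qed
  have measY: "Y n \<in> borel_measurable M" for n
    unfolding Y_def[abs_def] using measX by measurable
  have absY: "\<bar>Y n \<omega>\<bar> \<le> 1" for n \<omega>
  proof -
    have "\<bar>\<Sum>k\<in>S n. cos (X n k \<omega>)\<bar> \<le> (\<Sum>k\<in>S n. 1)"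
      by (rule order_trans[OF sum_abs sum_mono]) simp
    then show ?thesis using N[of n] by (simp add: Y_def)
  qed
  define u where "u n \<omega> = (Y n \<omega> - ?c)\<^sup>2" for n \<omega>
  have int: "integrable M (u n)" for n
  proof (rule integrable_const_bound[of _ 4])
    show "AE \<omega> in M. norm (u n \<omega>) \<le> 4"
    proof (intro AE_I2)
      fix \<omega>
      have "?c \<le> 1" "0 < ?c" by simp_all
      then have "\<bar>Y n \<omega> - ?c\<bar> \<le> 2" using absY[of n \<omega>] by argo
      then have "\<bar>Y n \<omega> - ?c\<bar>\<^sup>2 \<le> 2\<^sup>2" by (intro power_mono) auto
      then show "norm (u n \<omega>) \<le> 4" by (simp add: u_def)
    qed
    show "u n \<in> borel_measurable M" unfolding u_def[abs_def] using measY by measurable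
  qed
  have "(\<lambda>n. LINT \<omega>|M. norm (u n \<omega>)) \<longlonglongrightarrow> 0"
  proof (rule tendsto_sandwich[OF _ _ tendsto_const])
    let ?b = "\<lambda>n. \<Prod>i\<in>UNIV - {i0}. 2 * ((\<Sum>j<Suc n. (fgn_autocov (H $ i) (real j))\<^sup>2) / real (Suc n))"
    have "?b \<longlonglongrightarrow> (\<Prod>i\<in>UNIV - {i0}. 2 * 0)"
    proof (intro tendsto_prod tendsto_mult tendsto_const)
      fix i
      have "(\<lambda>j. (fgn_autocov (H $ i) (real j))\<^sup>2) \<longlonglongrightarrow> 0"
        using tendsto_power[OF fgn_autocov_tendsto_0[OF H], of i 2] by simp
      from LIMSEQ_Suc[OF cesaro_tendsto_0[OF this]]
      show "(\<lambda>n. (\<Sum>j<Suc n. (fgn_autocov (H $ i) (real j))\<^sup>2) / real (Suc n)) \<longlonglongrightarrow> 0" by simp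
    qed
    moreover have "(\<Prod>i\<in>UNIV - {i0}. 2 * 0 :: real) = 0"
      using ne by (intro prod_zero) auto
    ultimately show "?b \<longlonglongrightarrow> 0" by (simp only:)
    have "expectation (u n) \<le> ?b n" for n
    proof -
      have "expectation (u n) \<le> (\<Sum>k\<in>S n. \<Sum>l\<in>S n. (expectation (\<lambda>\<omega>. X n k \<omega> * X n l \<omega>))\<^sup>2) / (real (card (S n)))\<^sup>2"
        unfolding u_def Y_def by (intro cos_average_variance_le S gaussX meanX varX)
      also have "\<dots> = (\<Sum>k\<in>S n. \<Sum>l\<in>S n. (\<Prod>i\<in>UNIV. fgn_autocov (H $ i) (real (k i) - real (l i)))\<^sup>2)
          / (real (card (S n)))\<^sup>2"
        by (simp add: covX)
      also have "\<dots> \<le> ?b n"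
        unfolding S_def by (rule slab_mean_square_correlation_le) simp
      finally show ?thesis .
    qed
    moreover have "(LINT \<omega>|M. norm (u n \<omega>)) = expectation (u n)" for n
      by (simp add: u_def[abs_def])
    ultimately show "\<forall>\<^sub>F n in sequentially. (LINT \<omega>|M. norm (u n \<omega>)) \<le> ?b n"
      by (intro always_eventually allI) (simp only:)
  qed simp
  \<comment> \<open>A subsequence is enough, because chargeability makes the whole sequence \<open>Y n \<omega>\<close> tend to 1.\<close>
  then obtain r :: "nat \<Rightarrow> nat" where r: "strict_mono r" and "AE \<omega> in M. (\<lambda>n. u (r n) \<omega>) \<longlonglongrightarrow> 0"
    using tendsto_L1_AE_subseq[of M u] int by blast
  from this(2) show ?thesis
  proof eventually_elim
    case (elim \<omega>)
    show ?case
    proof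
      assume ch: "chargeable (\<lambda>t. W t \<omega>)"
      have lim: "(\<lambda>n. \<Sum>k\<in>S n. \<bar>D n k \<omega>\<bar>) \<longlonglongrightarrow> 0"
        using chargeable_sum_abs_rect_increment_tendsto_0[OF ch, of i0] by (simp add: S_def D_def)
      \<comment> \<open>The bound on the sum of the Hurst indices means that there are enough cubes to compensate
        for the size of the increments.\<close>
      have scale: "1 \<le> real (card (S n)) * \<sigma> n" for n
      proof -
        have "\<sigma> n = real (Suc n) powr (\<Sum>i\<in>UNIV. - (H $ i))"
          unfolding \<sigma>_def by (rule powr_sum[symmetric]) auto
        then have "real (card (S n)) * \<sigma> n = real (Suc n) powr (real CARD('n) - 1 - (\<Sum>i\<in>UNIV. H $ i))"
          using dim unfolding S(2)
          by (simp add: sum_negf of_nat_diff flip: powr_realpow powr_add)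
        then show ?thesis using sumH by (simp add: ge_one_powr_ge_zero)
      qed
      have bound: "\<bar>Y n \<omega> - 1\<bar> \<le> (\<Sum>k\<in>S n. \<bar>D n k \<omega>\<bar>)" for n
      proof -
        have "1 - Y n \<omega> = (\<Sum>k\<in>S n. 1 - cos (X n k \<omega>)) / card (S n)"
          using N[of n] by (simp add: Y_def sum_subtractf field_simps)
        also have "\<dots> \<le> (\<Sum>k\<in>S n. \<bar>X n k \<omega>\<bar>) / card (S n)"
          by (intro divide_right_mono sum_mono one_minus_cos_le_abs) simp
        also have "\<dots> = (\<Sum>k\<in>S n. \<bar>D n k \<omega>\<bar>) / (card (S n) * \<sigma> n)"
          using \<sigma>[of n] by (simp add: X_def sum_divide_distrib[symmetric] mult.commute)
        also have "\<dots> \<le> (\<Sum>k\<in>S n. \<bar>D n k \<omega>\<bar>) / 1"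
          using scale[of n] by (intro divide_left_mono sum_nonneg) auto
        finally show ?thesis using absY[of n \<omega>] by simp
      qed
      have "(\<lambda>n. Y n \<omega> - 1) \<longlonglongrightarrow> 0"
        by (rule Lim_null_comparison[OF _ lim]) (use bound in simp)
      then have "(\<lambda>n. Y n \<omega>) \<longlonglongrightarrow> 1" by (simp add: LIM_zero_iff)
      then have "(\<lambda>n. u n \<omega>) \<longlonglongrightarrow> (1 - ?c)\<^sup>2"
        unfolding u_def by (intro tendsto_intros)
      then have "(\<lambda>n. u (r n) \<omega>) \<longlonglongrightarrow> (1 - ?c)\<^sup>2"
        using LIMSEQ_subseq_LIMSEQ[OF _ r] by (simp add: o_def)
      then have "(1 - ?c)\<^sup>2 = 0" using elim LIMSEQ_unique by blast
      then show False by simp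
    qed
  qed
qed

end
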